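(* Let $M>0$, $0<\varepsilon<M$ and $T>0$. Let $f:\mathbb{R}\to\mathbb{R}$ be a $C^3$ function with $f''\in L^\infty(\mathbb{R})$ and let $w_0\in L^1(\mathbb{R})\cap BV(\mathbb{R})$ be real-valued with $|w_0|\le M$. Let $g(w)=w\,h(w)$, where $h=h_\varepsilon:\mathbb{R}\to\mathbb{R}$ is a regularization of the characteristic function of $[-M,M]$, that is, $h$ is Lipschitz continuous, $\operatorname{supp}h\subset[-M,M]$, and $h=1$ on $[-M+\varepsilon,M-\varepsilon]$. Let $w$ be the unique entropy solution on $[0,T]$ of $$\partial_t w(t,x)+\partial_x\Big(f'\Big(\int_{-\infty}^x w(t,z)\,dz\Big)\,g(w(t,x))\Big)=0,\qquad w(0,x)=w_0(x),$$ satisfying $\|w\|_{L^\infty((0,T)\times\mathbb{R})}\le M$ and $\|w(t)\|_{L^1(\mathbb{R})}\le\|w_0\|_{L^1(\mathbb{R})}$ for all $t\in[0,T]$. Define the following subsets of $(0,T)\times\mathbb{R}$: $$I_\varepsilon=\{(t,x):|w|\le M-\varepsilon\},\qquad J_\varepsilon=\{(t,x):|w|=M\},\qquad K_\varepsilon=\big((0,T)\times\mathbb{R}\big)\setminus(I_\varepsilon\cup J_\varepsilon),$$ and set $u(t,x):=\int_{-\infty}^x w(t,y)\,dy$. Then: (i) on $I_\varepsilon$, $u$ is an entropy solution of $\partial_t u+\partial_x(f(u))=0$ and $|\partial_x u|<M$; (ii) on $J_\varepsilon$, $|\partial_x u|=M$; (iii) on $K_\varepsilon$, $u$ solves $\partial_t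 u+\partial_x(f(u))\,h(w)=0$. Furthermore, $u\in L^\infty(0,T;W^{1,\infty}(\mathbb{R}))$. In particular, $u(t,\cdot)$ is continuous on $\mathbb{R}$ for each $t$.
   Context: Definition (entropy solution of the nonlocal problem). A function $w\in L^\infty([0,T];L^1\cap BV(\mathbb{R}))$ is an entropy solution on $[0,T]$ of the nonlocal problem with initial data $w_0$ if it is a weak entropy solution, in the standard (Kruzhkov) sense, of the Cauchy problem $$\partial_t w+\partial_x\big(k(t,x)g(w)\big)=0,\qquad w(0,x)=w_0(x),\qquad x\in\mathbb{R},\ t\in[0,T],$$ with $k(t,x)=f'\big(\int_{-\infty}^x w(t,z)\,dz\big)$. The standard sense means: $w$ is a weak (distributional) solution, and for every $c\in\mathbb{R}$ and every nonnegative $\varphi\in C_c^\infty([0,T)\times\mathbb{R})$, $$\int_0^T\!\!\int_{\mathbb{R}}\Big(|w-c|\,\partial_t\varphi+\operatorname{sgn}(w-c)\,k\,(g(w)-g(c))\,\partial_x\varphi-\operatorname{sgn}(w-c)\,\partial_xk\;g(c)\,\varphi\Big)dx\,dt+\int_{\mathbb{R}}|w_0(x)-c|\,\varphi(0,x)\,dx\ge0.$$ Existence and uniqueness of an entropy solution $w$ with the two stated bounds is taken as known. Meaning of statements on the sets. The sets $I_\varepsilon,J_\varepsilon,K_\varepsilon$ are measurable sets defined up to null sets. The equations and (in)equalities on them are understood almost everywhere on the corresponding set; "entropy solution on $I_\varepsilon$" means that $\partial_t u+\partial_x(f(u))=0$ and, for every $c\in\mathbb{R}$, $\partial_t|u-c|+\partial_x\big(\operatorname{sgn}(u-c)(f(u)-f(c))\big)\le0$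 almost everywhere on $I_\varepsilon$. *)

theory Defs
  imports "HOL-Analysis.Analysis" "HOL-Probability.Essential_Supremum"
begin

section \<open>Smooth functions, test functions, weak derivatives\<close>

primrec Ck :: "nat \<Rightarrow> ('a::euclidean_space \<Rightarrow> real) \<Rightarrow> bool" where
  "Ck 0 \<phi> \<longleftrightarrow> continuous_on UNIV \<phi>"
| "Ck (Suc n) \<phi> \<longleftrightarrow> (\<forall>p. \<phi> differentiable (at p)) \<and>
     (\<forall>e\<in>Basis. Ck n (\<lambda>p. frechet_derivative \<phi> (at p) e))"

text \<open>Functions in \<open>test_functions S\<close> are smooth on the whole space and their support is a
  compact subset of \<open>S\<close>. In particular the elements of \<open>test_functions ({..<T} \<times> UNIV)\<close>
  need not vanish at time \<open>0\<close>; their restrictions to nonnegative times are exactly the functions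
  in \<open>C_c^\<infinity>([0,T) \<times> \<real>)\<close>.\<close>

definition test_functions :: "'a::euclidean_space set \<Rightarrow> ('a \<Rightarrow> real) set" where
  "test_functions S =
     {\<phi>. (\<forall>n. Ck n \<phi>) \<and> (\<exists>K. compact K \<and> K \<subseteq> S \<and> (\<forall>p. p \<notin> K \<longrightarrow> \<phi> p = 0))}"

definition locally_integrable_on :: "('a::euclidean_space \<Rightarrow> real) \<Rightarrow> 'a set \<Rightarrow> bool" where
  "locally_integrable_on v S \<longleftrightarrow> (\<forall>K. compact K \<and> K \<subseteq> S \<longrightarrow> set_integrable lebesgue K v)"

text \<open>\<open>has_weak_derivative S v e v'\<close>: on the open set \<open>S\<close>, the distributional derivative of \<open>v\<close>
  in direction \<open>e\<close> is the locally integrable function \<open>v'\<close> (which is thus determined almost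
  everywhere on \<open>S\<close>).\<close>

definition has_weak_derivative ::
  "'a::euclidean_space set \<Rightarrow> ('a \<Rightarrow> real) \<Rightarrow> 'a \<Rightarrow> ('a \<Rightarrow> real) \<Rightarrow> bool" where
  "has_weak_derivative S v e v' \<longleftrightarrow>
     locally_integrable_on v S \<and> locally_integrable_on v' S \<and>
     (\<forall>\<phi>\<in>test_functions S.
        (LINT p:S|lebesgue. v p * frechet_derivative \<phi> (at p) e) =
        - (LINT p:S|lebesgue. v' p * \<phi> p))"

section \<open>Function spaces\<close>

definition Linf_norm :: "'a::euclidean_space set \<Rightarrow> ('a \<Rightarrow> real) \<Rightarrow> ereal" where
  "Linf_norm S v = esssup (lebesgue_on S) (\<lambda>p. ereal \<bar>v p\<bar>)"

definition Linf_on :: "'a::euclidean_space set \<Rightarrow> ('a \<Rightarrow> real) \<Rightarrow> bool" where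
  "Linf_on S v \<longleftrightarrow> v \<in> borel_measurable (lebesgue_on S) \<and> Linf_norm S v < \<infinity>"

definition L1_norm :: "(real \<Rightarrow> real) \<Rightarrow> real" where
  "L1_norm v = (LINT x|lebesgue. \<bar>v x\<bar>)"

text \<open>The essential total variation, i.e. the total mass of the distributional derivative.\<close>

definition total_variation :: "(real \<Rightarrow> real) \<Rightarrow> ereal" where
  "total_variation v =
     (SUP \<phi>\<in>{\<phi> \<in> test_functions UNIV. \<forall>x. \<bar>\<phi> x\<bar> \<le> 1}.
        ereal (LINT x|lebesgue. v x * frechet_derivative \<phi> (at x) 1))"

definition in_L1_BV :: "(real \<Rightarrow> real) \<Rightarrow> bool" where
  "in_L1_BV v \<longleftrightarrow> integrable lebesgue v \<and> total_variation v < \<infinity>"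

text \<open>For the two time-dependent spaces below, measurability in time is understood as joint
  measurability in \<open>(t,x)\<close>: \<open>BV\<close> and \<open>W^{1,\<infinity>}\<close> are not separable, and Bochner measurability
  with values in them would already fail for a moving jump or kink.\<close>

definition Linf_L1_BV :: "real \<Rightarrow> (real \<Rightarrow> real \<Rightarrow> real) \<Rightarrow> bool" where
  "Linf_L1_BV T w \<longleftrightarrow>
     (\<lambda>(t, x). w t x) \<in> borel_measurable (lebesgue_on ({0..T} \<times> UNIV)) \<and>
     (\<exists>C::real. AE t in lebesgue_on {0..T}.
        in_L1_BV (w t) \<and> ereal (L1_norm (w t)) + total_variation (w t) \<le> ereal C)"

definition Linf_W1inf :: "real \<Rightarrow> (real \<Rightarrow> real \<Rightarrow> real) \<Rightarrow> bool" where
  "Linf_W1inf T u \<longleftrightarrow>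
     (\<lambda>(t, x). u t x) \<in> borel_measurable (lebesgue_on ({0<..<T} \<times> UNIV)) \<and>
     (\<exists>C::real. AE t in lebesgue_on {0<..<T}.
        \<exists>v. has_weak_derivative UNIV (u t) 1 v \<and>
            Linf_norm UNIV (u t) + Linf_norm UNIV v \<le> ereal C)"

section \<open>Entropy solutions\<close>

definition weak_solution ::
  "real \<Rightarrow> (real \<Rightarrow> real \<Rightarrow> real) \<Rightarrow> (real \<Rightarrow> real) \<Rightarrow> (real \<Rightarrow> real) \<Rightarrow> (real \<Rightarrow> real \<Rightarrow> real) \<Rightarrow> bool"
where
  "weak_solution T k g w0 w \<longleftrightarrow>
     (\<forall>\<phi>\<in>test_functions ({..<T} \<times> UNIV).
        (LINT (t, x):{0<..<T} \<times> UNIV|lebesgue.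
            w t x * frechet_derivative \<phi> (at (t, x)) (1, 0)
          + k t x * g (w t x) * frechet_derivative \<phi> (at (t, x)) (0, 1))
        + (LINT x|lebesgue. w0 x * \<phi> (0, x)) = 0)"

text \<open>The derivative \<open>\<partial>\<^sub>x k\<close> in Kruzhkov's inequality is the weak one.\<close>

definition weak_entropy_solution ::
  "real \<Rightarrow> (real \<Rightarrow> real \<Rightarrow> real) \<Rightarrow> (real \<Rightarrow> real) \<Rightarrow> (real \<Rightarrow> real) \<Rightarrow> (real \<Rightarrow> real \<Rightarrow> real) \<Rightarrow> bool"
where
  "weak_entropy_solution T k g w0 w \<longleftrightarrow>
     weak_solution T k g w0 w \<and>
     (\<exists>kx. has_weak_derivative ({0<..<T} \<times> UNIV) (\<lambda>(t, x). k t x) (0, 1) kx \<and>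
       (\<forall>c. \<forall>\<phi>\<in>test_functions ({..<T} \<times> UNIV). (\<forall>t\<ge>0. \<forall>x. 0 \<le> \<phi> (t, x)) \<longrightarrow>
          (LINT (t, x):{0<..<T} \<times> UNIV|lebesgue.
              \<bar>w t x - c\<bar> * frechet_derivative \<phi> (at (t, x)) (1, 0)
            + sgn (w t x - c) * k t x * (g (w t x) - g c) * frechet_derivative \<phi> (at (t, x)) (0, 1)
            - sgn (w t x - c) * kx (t, x) * g c * \<phi> (t, x))
          + (LINT x|lebesgue. \<bar>w0 x - c\<bar> * \<phi> (0, x)) \<ge> 0))"

definition primitive :: "(real \<Rightarrow> real \<Rightarrow> real) \<Rightarrow> real \<Rightarrow> real \<Rightarrow> real" where
  "primitive w t x = (LINT z:{..x}|lebesgue. w t z)"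

definition nonlocal_entropy_solution ::
  "real \<Rightarrow> (real \<Rightarrow> real) \<Rightarrow> (real \<Rightarrow> real) \<Rightarrow> (real \<Rightarrow> real) \<Rightarrow> (real \<Rightarrow> real \<Rightarrow> real) \<Rightarrow> bool"
where
  "nonlocal_entropy_solution T f g w0 w \<longleftrightarrow>
     Linf_L1_BV T w \<and>
     weak_entropy_solution T (\<lambda>t x. deriv f (primitive w t x)) g w0 w"

text \<open>Entropy solution of \<open>\<partial>\<^sub>t u + \<partial>\<^sub>x (f(u)) = 0\<close> almost everywhere on a set \<open>E\<close> that is merely
  measurable: the derivatives are weak derivatives on the strip \<open>(0,T) \<times> \<real>\<close>, required to be
  functions, and the relations hold almost everywhere on \<open>E\<close>.\<close>

definition entropy_solution_ae_on ::
  "real \<Rightarrow> (real \<Rightarrow> real) \<Rightarrow> (real \<times> real) set \<Rightarrow> (real \<Rightarrow> real \<Rightarrow> real) \<Rightarrow> bool" where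
  "entropy_solution_ae_on T f E u \<longleftrightarrow>
     (\<exists>ut fx.
        has_weak_derivative ({0<..<T} \<times> UNIV) (\<lambda>(t, x). u t x) (1, 0) ut \<and>
        has_weak_derivative ({0<..<T} \<times> UNIV) (\<lambda>(t, x). f (u t x)) (0, 1) fx \<and>
        (AE p in lebesgue. p \<in> E \<longrightarrow> ut p + fx p = 0)) \<and>
     (\<forall>c. \<exists>\<eta>t qx.
        has_weak_derivative ({0<..<T} \<times> UNIV) (\<lambda>(t, x). \<bar>u t x - c\<bar>) (1, 0) \<eta>t \<and>
        has_weak_derivative ({0<..<T} \<times> UNIV)
          (\<lambda>(t, x). sgn (u t x - c) * (f (u t x) - f c)) (0, 1) qx \<and>
        (AE p in lebesgue. p \<in> E \<longrightarrow> \<eta>t p + qx p \<le> 0))"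

definition regularized_indicator :: "real \<Rightarrow> real \<Rightarrow> (real \<Rightarrow> real) \<Rightarrow> bool" where
  "regularized_indicator M \<epsilon> h \<longleftrightarrow>
     (\<exists>L. L-lipschitz_on UNIV h) \<and> closure {y. h y \<noteq> 0} \<subseteq> {-M..M} \<and>
     (\<forall>y\<in>{-M + \<epsilon>..M - \<epsilon>}. h y = 1)"

section \<open>The sets of the decomposition\<close>

definition I_set :: "real \<Rightarrow> real \<Rightarrow> real \<Rightarrow> (real \<Rightarrow> real \<Rightarrow> real) \<Rightarrow> (real \<times> real) set" where
  "I_set T M \<epsilon> w = {(t, x). 0 < t \<and> t < T \<and> \<bar>w t x\<bar> \<le> M - \<epsilon>}"

definition J_set :: "real \<Rightarrow> real \<Rightarrow> (real \<Rightarrow> real \<Rightarrow> real) \<Rightarrow> (real \<times> real) set" where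
  "J_set T M w = {(t, x). 0 < t \<and> t < T \<and> \<bar>w t x\<bar> = M}"

definition K_set :: "real \<Rightarrow> real \<Rightarrow> real \<Rightarrow> (real \<Rightarrow> real \<Rightarrow> real) \<Rightarrow> (real \<times> real) set" where
  "K_set T M \<epsilon> w = ({0<..<T} \<times> UNIV) - (I_set T M \<epsilon> w \<union> J_set T M w)"

end

theory Submission
  imports Defs
begin

text \<open>Integrating the conservation law for \<open>w\<close> once in \<open>x\<close> gives a pointwise relation for its
  primitive \<open>u\<close>. Indeed \<open>\<partial>\<^sub>x u = w\<close>, and \<open>\<partial>\<^sub>x (\<partial>\<^sub>t u + f'(u) g(w)) = 0\<close> while the bracket vanishes at
  \<open>x = -\<infinity>\<close>, so that \<open>\<partial>\<^sub>t u = - f'(u) g(w)\<close>. Both derivatives are bounded functions, because \<open>\<bar>w\<bar> \<le> M\<close> and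
  \<open>\<bar>u\<bar> \<le> \<parallel>w\<^sub>0\<parallel>\<close> in \<open>L\<^sup>1\<close>. With the chain rule \<open>\<partial>\<^sub>x f(u) = f'(u) w\<close> and \<open>g(w) = w h(w)\<close> this reads
  \<open>\<partial>\<^sub>t u + h(w) \<partial>\<^sub>x f(u) = 0\<close> almost everywhere on the whole strip. On the set where \<open>\<bar>w\<bar> \<le> M - \<epsilon>\<close> the factor
  \<open>h(w)\<close> is \<open>1\<close>. The entropy inequality holds there with equality: \<open>u\<close> has no jumps, so
  \<open>\<partial>\<^sub>t \<bar>u - c\<bar> = sgn (u - c) \<partial>\<^sub>t u\<close> and the entropy flux has \<open>x\<close>-derivative \<open>sgn (u - c) \<partial>\<^sub>x f(u)\<close>. The bounds on
  \<open>\<partial>\<^sub>x u\<close> are those on \<open>w\<close>.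

  Two points need an argument. To test the equation for \<open>w\<close> with an \<open>x\<close>-primitive of a test function
  \<open>\<phi>\<close>, which has no compact support, the function \<open>\<integral>\<^sub>0\<^sup>n \<phi>(t, x + s) ds\<close> is used instead. It is a test function, and its
  \<open>x\<close>-derivative \<open>\<phi>(t, x + n) - \<phi>(t, x)\<close> differs from \<open>- \<phi>\<close> by a term that moves to infinity, where the
  integrable functions \<open>w\<close> and \<open>f'(u) g(w)\<close> do not see it. This is the content of
  \<open>distributional_derivative_primitive\<close> and \<open>distributional_derivative_primitive_of_conservation_law\<close>.

  The other point is the chain rule for weak derivatives, \<open>distributional_chain_rule\<close>. The same averages over segments turn the
  weak derivative \<open>v\<close> of \<open>u\<close> along \<open>e\<close> into the statement
  \<open>u(p + h e) - u(p) = h \<integral>\<^sub>0\<^sup>1 v(p + s h e) ds\<close> for almost every \<open>p\<close> with \<open>\<phi>(p) \<noteq> 0\<close>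
  (\<open>distributional_increment\<close>): a product of \<open>\<phi>\<close> and a polynomial is again a test function, so the difference of the two sides,
  multiplied by \<open>\<phi>\<close>, is orthogonal to all polynomials. Thus no mollifiers occur, and the mean value theorem and
  difference quotients give the chain rule for \<open>C\<^sup>1\<close> functions. The entropy pairs follow by smoothing
  \<open>\<bar>y - c\<bar>\<close> (\<open>distributional_entropy_flux\<close>).

  All integrals are computed with Borel representatives over \<open>lborel\<close>, where Fubini's theorem applies without
  measurability problems; \<open>has_weak_derivative_iff_borel_version\<close> translates back.\<close>

section \<open>Smooth functions and their averages over segments\<close>

lemma Ck_continuous:
  assumes "Ck n \<phi>" shows "continuous_on UNIV \<phi>"
proof (cases n)
  case (Suc m)
  then show ?thesis
    using assms by (auto intro!: continuous_at_imp_continuous_on differentiable_imp_continuous_within)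
qed (use assms in simp)

text \<open>Lets a proof of smoothness name the derivative, so that the recursive definition of \<open>Ck\<close> need not be unfolded at
  \<open>frechet_derivative\<close>.\<close>

lemma Ck_SucI:
  assumes "\<And>p. (\<phi> has_derivative D p) (at p)" "\<And>e. e \<in> Basis \<Longrightarrow> Ck n (\<lambda>p. D p e)"
  shows "Ck (Suc n) \<phi>"
proof -
  have "frechet_derivative \<phi> (at p) = D p" for p
    using frechet_derivative_at[OF assms(1)] by simp
  then show ?thesis
    using assms by (auto simp: differentiable_def)
qed

lemma Ck_has_derivative:
  "Ck (Suc n) \<phi> \<Longrightarrow> (\<phi> has_derivative frechet_derivative \<phi> (at p)) (at p)"
  by (simp add: frechet_derivative_works[symmetric])

lemma Ck_frechet: "Ck (Suc n) \<phi> \<Longrightarrow> e \<in> Basis \<Longrightarrow> Ck n (\<lambda>p. frechet_derivative \<phi> (at p) e)"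
  by simp

lemma Ck_antimono: "Ck (Suc n) \<phi> \<Longrightarrow> Ck n \<phi>"
proof (induction n arbitrary: \<phi>)
  case 0 then show ?case using Ck_continuous[OF 0] by simp
next
  case (Suc n) then show ?case using Ck.simps(2) by metis
qed

lemma Ck_const: "Ck n (\<lambda>p. c)"
proof (induction n arbitrary: c)
  case (Suc n)
  show ?case by (rule Ck_SucI[OF has_derivative_const Suc])
qed simp

lemma Ck_bounded_linear:
  assumes "bounded_linear \<phi>" shows "Ck n \<phi>"
proof (cases n)
  case 0 then show ?thesis using assms by (simp add: linear_continuous_on)
next
  case (Suc m)
  show ?thesis unfolding Suc
    by (rule Ck_SucI[OF bounded_linear_imp_has_derivative[OF assms]]) (rule Ck_const)
qed

lemma Ck_add: "Ck n \<phi> \<Longrightarrow> Ck n \<psi> \<Longrightarrow> Ck n (\<lambda>p. \<phi> p + \<psi> p)"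
proof (induction n arbitrary: \<phi> \<psi>)
  case 0 then show ?case by (auto intro: continuous_intros)
next
  case (Suc n)
  show ?case
    by (rule Ck_SucI[OF has_derivative_add[OF Ck_has_derivative[OF Suc.prems(1)]
             Ck_has_derivative[OF Suc.prems(2)]]])
       (intro Suc.IH Ck_frechet Suc.prems)
qed

lemma Ck_mult: "Ck n \<phi> \<Longrightarrow> Ck n \<psi> \<Longrightarrow> Ck n (\<lambda>p. \<phi> p * \<psi> p)"
proof (induction n arbitrary: \<phi> \<psi>)
  case 0 then show ?case by (auto intro: continuous_intros)
next
  case (Suc n)
  show ?case
    by (rule Ck_SucI[OF has_derivative_mult[OF Ck_has_derivative[OF Suc.prems(1)]
             Ck_has_derivative[OF Suc.prems(2)]]])
       (intro Ck_add Suc.IH Ck_frechet Suc.prems Ck_antimono[OF Suc.prems(1)]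
         Ck_antimono[OF Suc.prems(2)])
qed

lemma Ck_polynomial: "real_polynomial_function P \<Longrightarrow> Ck n P"
  by (induction P rule: real_polynomial_function.induct)
     (auto intro: Ck_bounded_linear Ck_const Ck_add Ck_mult)

lemma Ck_continuous_frechet:
  fixes \<phi> :: "'a::euclidean_space \<Rightarrow> real"
  assumes "Ck (Suc n) \<phi>"
  shows "continuous_on UNIV (\<lambda>p. frechet_derivative \<phi> (at p) e)"
proof -
  have lin: "linear (frechet_derivative \<phi> (at p))" for p
    using Ck_has_derivative[OF assms] has_derivative_linear by blast
  have eq: "frechet_derivative \<phi> (at p) e =
      (\<Sum>b\<in>Basis. (e \<bullet> b) * frechet_derivative \<phi> (at p) b)" for p
  proof -
    have "frechet_derivative \<phi> (at p) (\<Sum>b\<in>Basis. (e \<bullet> b) *\<^sub>R b) =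
        (\<Sum>b\<in>Basis. (e \<bullet> b) * frechet_derivative \<phi> (at p) b)"
      by (simp add: linear_sum[OF lin] linear_scale[OF lin])
    then show ?thesis by (simp add: euclidean_representation)
  qed
  show ?thesis unfolding eq
    by (intro continuous_intros Ck_continuous[OF Ck_frechet[OF assms]])
qed

text \<open>The mean of \<open>\<phi>\<close> over the segment from \<open>p\<close> to \<open>p + a\<close>. The Henstock-Kurzweil integral
  is chosen because \<open>leibniz_rule\<close> and \<open>fundamental_theorem_of_calculus\<close> speak of it;
  \<open>segment_average_lborel\<close> passes to the Lebesgue integral.\<close>

definition segment_average :: "'a::euclidean_space \<Rightarrow> ('a \<Rightarrow> real) \<Rightarrow> 'a \<Rightarrow> real" where
  "segment_average a \<phi> p = integral {0..1} (\<lambda>s. \<phi> (p + s *\<^sub>R a))"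

lemma segment_average_has_derivative:
  fixes \<phi> :: "'a::euclidean_space \<Rightarrow> real"
  assumes "Ck (Suc n) \<phi>"
  shows "(segment_average a \<phi> has_derivative
      (\<lambda>e. segment_average a (\<lambda>p. frechet_derivative \<phi> (at p) e) p)) (at p)"
proof -
  define D where "D q = Blinfun (frechet_derivative \<phi> (at q))" for q
  have D: "blinfun_apply (D q) = frechet_derivative \<phi> (at q)" for q
    unfolding D_def using Ck_has_derivative[OF assms, of q]
    by (intro bounded_linear_Blinfun_apply has_derivative_bounded_linear)
  have contD: "continuous_on UNIV D"
    by (rule continuous_on_blinfun_componentwise) (simp add: D Ck_continuous_frechet[OF assms])
  have cont: "continuous_on A (\<lambda>s. \<phi> (p + s *\<^sub>R a))" for A p
    by (intro continuous_on_compose2[OF Ck_continuous[OF assms]] continuous_intros) auto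
  have contD': "continuous_on A (\<lambda>s. D (p + s *\<^sub>R a))" for A p
    by (intro continuous_on_compose2[OF contD] continuous_intros) auto
  have "((\<lambda>p. integral (cbox 0 1) (\<lambda>s. \<phi> (p + s *\<^sub>R a))) has_derivative
      integral (cbox 0 1) (\<lambda>s. D (p + s *\<^sub>R a))) (at p within UNIV)"
  proof (rule leibniz_rule)
    fix x and t :: real
    have "(\<phi> has_derivative D (x + t *\<^sub>R a)) (at (x + t *\<^sub>R a))"
      unfolding D by (rule Ck_has_derivative[OF assms])
    then show "((\<lambda>x. \<phi> (x + t *\<^sub>R a)) has_derivative D (x + t *\<^sub>R a)) (at x within UNIV)"
      by (rule has_derivative_compose[rotated, where f="\<lambda>x. x + t *\<^sub>R a" and f'="\<lambda>x. x", simplified])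
         (auto intro!: derivative_eq_intros)
  next
    show "continuous_on (UNIV \<times> cbox 0 1) (\<lambda>(x, t::real). D (x + t *\<^sub>R a))"
      unfolding split_beta by (intro continuous_on_compose2[OF contD] continuous_intros) auto
  qed (auto intro!: integrable_continuous_real cont)
  moreover have "blinfun_apply (integral (cbox 0 1) (\<lambda>s. D (p + s *\<^sub>R a))) =
      (\<lambda>e. segment_average a (\<lambda>p. frechet_derivative \<phi> (at p) e) p)"
  proof
    fix e
    have "((\<lambda>s. D (p + s *\<^sub>R a)) has_integral integral (cbox 0 1) (\<lambda>s. D (p + s *\<^sub>R a))) (cbox 0 1)"
      by (intro integrable_integral integrable_continuous contD')
    then have "((\<lambda>s. D (p + s *\<^sub>R a) e) has_integral integral (cbox 0 1) (\<lambda>s. D (p + s *\<^sub>R a)) e) (cbox 0 1)"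
      by (rule has_integral_linear[OF _ blinfun.bounded_linear_left[of e], unfolded o_def])
    then show "integral (cbox 0 1) (\<lambda>s. D (p + s *\<^sub>R a)) e
        = segment_average a (\<lambda>p. frechet_derivative \<phi> (at p) e) p"
      by (simp add: segment_average_def D integral_unique)
  qed
  ultimately show ?thesis
    by (simp add: segment_average_def[abs_def])
qed

lemma Ck_segment_average: "Ck n \<phi> \<Longrightarrow> Ck n (segment_average a \<phi>)"
proof (induction n arbitrary: \<phi>)
  case 0
  have "continuous_on UNIV (\<lambda>p. integral (cbox 0 1) (\<lambda>s. \<phi> (p + s *\<^sub>R a)))"
    using 0 unfolding Ck.simps
    by (intro integral_continuous_on_param, unfold split_beta)
       (rule continuous_on_compose2[where g=\<phi>], assumption, intro continuous_intros, simp)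
  then show ?case by (simp add: segment_average_def[abs_def])
next
  case (Suc n)
  show ?case
    by (rule Ck_SucI[OF segment_average_has_derivative[OF Suc.prems]])
       (intro Suc.IH Ck_frechet Suc.prems)
qed

text \<open>The reason for averaging over segments: the derivative of the average along the segment is a difference of two values of \<open>\<phi>\<close>.
  A statement about derivatives of test functions thereby becomes one about increments.\<close>

lemma segment_average_increment:
  fixes \<phi> :: "'a::euclidean_space \<Rightarrow> real"
  assumes "Ck (Suc n) \<phi>"
  shows "segment_average a (\<lambda>p. frechet_derivative \<phi> (at p) a) p = \<phi> (p + a) - \<phi> p"
proof -
  have "((\<lambda>s. frechet_derivative \<phi> (at (p + s *\<^sub>R a)) a) has_integral
      \<phi> (p + 1 *\<^sub>R a) - \<phi> (p + 0 *\<^sub>R a)) {0..1}"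
  proof (rule fundamental_theorem_of_calculus)
    fix s :: real
    let ?D = "frechet_derivative \<phi> (at (p + s *\<^sub>R a))"
    have lin: "linear ?D"
      using Ck_has_derivative[OF assms] has_derivative_linear by blast
    have "((\<lambda>s. p + s *\<^sub>R a) has_derivative (\<lambda>t. t *\<^sub>R a)) (at s within {0..1})"
      by (auto intro!: derivative_eq_intros)
    from has_derivative_compose[OF this Ck_has_derivative[OF assms]]
    show "((\<lambda>s. \<phi> (p + s *\<^sub>R a)) has_vector_derivative ?D a) (at s within {0..1})"
      by (simp add: has_vector_derivative_def linear_scale[OF lin])
  qed simp
  then show ?thesis by (simp add: segment_average_def integral_unique)
qed

lemma frechet_derivative_segment_average:
  fixes \<phi> :: "'a::euclidean_space \<Rightarrow> real"
  assumes "Ck (Suc n) \<phi>"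
  shows "frechet_derivative (segment_average a \<phi>) (at p) e
     = segment_average a (\<lambda>p. frechet_derivative \<phi> (at p) e) p"
  using frechet_derivative_at[OF segment_average_has_derivative[OF assms]] by metis

lemma segment_average_lborel:
  assumes "continuous_on UNIV \<phi>"
  shows "segment_average a \<phi> p = (LINT s:{0..1}|lborel. \<phi> (p + s *\<^sub>R a))"
proof -
  have "set_integrable lborel {0..1} (\<lambda>s. \<phi> (p + s *\<^sub>R a))"
    by (intro borel_integrable_atLeastAtMost' continuous_on_compose2[OF assms] continuous_intros) auto
  from set_borel_integral_eq_integral(2)[OF this] show ?thesis
    by (simp add: segment_average_def)
qed

section \<open>Test functions\<close>

lemma test_functionsD:
  assumes "\<phi> \<in> test_functions S"
  shows "Ck n \<phi>" and "continuous_on UNIV \<phi>" and "(\<phi> has_derivative frechet_derivative \<phi> (at p)) (at p)"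
proof -
  have *: "Ck n \<phi>" for n using assms by (simp add: test_functions_def del: Ck.simps)
  show "Ck n \<phi>" by (rule *)
  show "continuous_on UNIV \<phi>" by (rule Ck_continuous[OF *])
  show "(\<phi> has_derivative frechet_derivative \<phi> (at p)) (at p)" by (rule Ck_has_derivative[OF *])
qed

lemma test_functions_support:
  assumes "\<phi> \<in> test_functions S"
  obtains K where "compact K" "K \<subseteq> S" "\<And>p. p \<notin> K \<Longrightarrow> \<phi> p = 0"
    "\<And>p e. p \<notin> K \<Longrightarrow> frechet_derivative \<phi> (at p) e = 0"
proof -
  obtain K where K: "compact K" "K \<subseteq> S" "\<And>p. p \<notin> K \<Longrightarrow> \<phi> p = 0"
    using assms by (auto simp: test_functions_def)
  have "frechet_derivative \<phi> (at p) e = 0" if "p \<notin> K" for p e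
  proof -
    have "(\<phi> has_derivative (\<lambda>_. 0)) (at p)"
      by (rule has_derivative_transform_within_open[where f="\<lambda>_. 0" and s="- K"])
         (use K that compact_imp_closed in \<open>auto simp: open_Compl\<close>)
    then show ?thesis using frechet_derivative_at by metis
  qed
  with K show ?thesis using that by blast
qed

lemma test_functions_mono: "S \<subseteq> S' \<Longrightarrow> test_functions S \<subseteq> test_functions S'"
  unfolding test_functions_def by blast

text \<open>One test function yields enough others to determine a function almost everywhere where it does not vanish,
  by density of the polynomials.\<close>

lemma test_functions_mult_polynomial:
  assumes "\<phi> \<in> test_functions S" "real_polynomial_function P"
  shows "(\<lambda>p. \<phi> p * P p) \<in> test_functions S"
proof -
  obtain K where "compact K" "K \<subseteq> S" "\<And>p. p \<notin> K \<Longrightarrow> \<phi> p = 0"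
    using assms(1) by (auto simp: test_functions_def)
  moreover have "Ck n (\<lambda>p. \<phi> p * P p)" for n
    by (intro Ck_mult Ck_polynomial assms(2) test_functionsD(1)[OF assms(1)])
  ultimately show ?thesis unfolding test_functions_def by auto
qed

lemma test_functions_segment_average:
  assumes \<phi>: "\<phi> \<in> test_functions S" and K: "compact K" "\<And>p. p \<notin> K \<Longrightarrow> \<phi> p = 0"
    and S': "\<And>p s. p \<in> K \<Longrightarrow> s \<in> {0..1} \<Longrightarrow> p - s *\<^sub>R a \<in> S'"
  shows "segment_average a \<phi> \<in> test_functions S'"
proof -
  define K' where "K' = (\<lambda>(p, s). p - s *\<^sub>R a) ` (K \<times> {0..1::real})"
  have "compact K'"
    unfolding K'_def using K(1)
    by (intro compact_continuous_image compact_Times) (auto simp: split_beta intro!: continuous_intros)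
  moreover have "K' \<subseteq> S'" using S' by (auto simp: K'_def)
  moreover have "segment_average a \<phi> p = 0" if "p \<notin> K'" for p
  proof -
    have "\<phi> (p + s *\<^sub>R a) = 0" if "s \<in> {0..1}" for s
    proof (rule K(2))
      show "p + s *\<^sub>R a \<notin> K"
      proof
        assume "p + s *\<^sub>R a \<in> K"
        with \<open>s \<in> {0..1}\<close> have "p + s *\<^sub>R a - s *\<^sub>R a \<in> K'"
          unfolding K'_def by force
        with \<open>p \<notin> K'\<close> show False by simp
      qed
    qed
    then have "segment_average a \<phi> p = integral {0..1::real} (\<lambda>_. 0)"
      unfolding segment_average_def by (intro integral_cong) auto
    then show ?thesis by simp
  qed
  ultimately show ?thesis
    using Ck_segment_average[OF test_functionsD(1)[OF \<phi>]] unfolding test_functions_def by blast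
qed

section \<open>Integration against translates\<close>

lemma continuous_compact_support_bounded:
  fixes \<psi> :: "'a::euclidean_space \<Rightarrow> real"
  assumes "continuous_on UNIV \<psi>" "compact K" "\<And>p. p \<notin> K \<Longrightarrow> \<psi> p = 0"
  obtains B where "0 < B" "\<And>p. \<bar>\<psi> p\<bar> \<le> B"
proof -
  have "bounded (\<psi> ` K)"
    using assms by (intro compact_imp_bounded compact_continuous_image) (auto intro: continuous_on_subset)
  then obtain B where "0 < B" "\<And>p. p \<in> K \<Longrightarrow> \<bar>\<psi> p\<bar> \<le> B"
    unfolding bounded_pos by auto
  then show ?thesis using assms(3) that by (metis abs_zero less_imp_le)
qed

lemma integrable_bounded_compact_support:
  fixes H :: "'a::euclidean_space \<Rightarrow> real"
  assumes "H \<in> borel_measurable borel" "\<And>p. \<bar>H p\<bar> \<le> B" "compact K" "\<And>p. p \<notin> K \<Longrightarrow> H p = 0"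
  shows "integrable lborel H"
proof (rule Bochner_Integration.integrable_bound)
  show "integrable lborel (\<lambda>p. indicator K p * B)"
    using assms(3) emeasure_compact_finite[of K]
    by (intro integrable_mult_left integrable_real_indicator) (auto simp: compact_imp_closed borel_closed)
  show "AE p in lborel. norm (H p) \<le> norm (indicator K p * B)"
  proof (rule AE_I2)
    fix p show "norm (H p) \<le> norm (indicator K p * B)"
      using assms(2)[of p] assms(4)[of p] by (cases "p \<in> K") auto
  qed
qed (use assms in simp)

lemma integrable_mult_bounded:
  fixes F \<psi> :: "'a::euclidean_space \<Rightarrow> real"
  assumes F: "integrable lborel F"
    and [measurable]: "\<psi> \<in> borel_measurable borel" and B: "\<And>p. \<bar>\<psi> p\<bar> \<le> B"
  shows "integrable lborel (\<lambda>p. F p * \<psi> p)"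
proof (rule Bochner_Integration.integrable_bound[OF integrable_mult_left[OF F, of B]])
  have [measurable]: "F \<in> borel_measurable borel"
    using borel_measurable_integrable[OF F] by simp
  show "(\<lambda>p. F p * \<psi> p) \<in> borel_measurable lborel" by measurable
  show "AE p in lborel. norm (F p * \<psi> p) \<le> norm (F p * B)"
    unfolding norm_mult by (intro AE_I2 mult_left_mono) (auto intro: order_trans[OF B])
qed

lemma continuous_bounded_on_interval:
  fixes f :: "real \<Rightarrow> real"
  assumes "continuous_on UNIV f"
  obtains b where "\<And>y. \<bar>y\<bar> \<le> C \<Longrightarrow> \<bar>f y\<bar> \<le> b"
proof -
  have "bounded (f ` {-C..C})"
    by (intro compact_imp_bounded compact_continuous_image continuous_on_subset[OF assms]) auto
  then obtain b where "\<forall>y\<in>{-C..C}. \<bar>f y\<bar> \<le> b" unfolding bounded_iff by auto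
  then show ?thesis by (intro that[of b]) (auto simp: abs_le_iff)
qed

lemma lborel_integral_shift:
  fixes f :: "'a::euclidean_space \<Rightarrow> real"
  assumes [measurable]: "f \<in> borel_measurable borel"
  shows "(LINT p|lborel. f (p + a)) = (LINT p|lborel. f p)"
proof -
  have "(LINT p|lborel. f p) = (LINT p|distr lborel borel ((+) a). f p)"
    by (simp add: lborel_distr_plus)
  also have "\<dots> = (LINT p|lborel. f (a + p))"
    by (subst integral_distr) auto
  finally show ?thesis by (simp add: add.commute)
qed

lemma lborel_integrable_shift:
  fixes f :: "'a::euclidean_space \<Rightarrow> real"
  assumes "integrable lborel f"
  shows "integrable lborel (\<lambda>p. f (p + a))"
proof -
  have [measurable]: "f \<in> borel_measurable borel"
    using borel_measurable_integrable[OF assms] by simp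
  have "integrable (distr lborel borel ((+) a)) f"
    using assms by (simp add: lborel_distr_plus)
  then have "integrable lborel (\<lambda>p. f (a + p))"
    by (subst (asm) integrable_distr_eq) auto
  then show ?thesis by (simp add: add.commute)
qed

text \<open>Fubini's theorem for a parameter in \<open>[0, 1]\<close>; the uniform \<open>L\<^sup>1\<close> bound gives joint integrability.\<close>

lemma integral_segment_commute:
  fixes F :: "'a::euclidean_space \<Rightarrow> real \<Rightarrow> real"
  assumes meas: "case_prod F \<in> borel_measurable (borel \<Otimes>\<^sub>M borel)"
    and int: "\<And>s. s \<in> {0..1} \<Longrightarrow> integrable lborel (\<lambda>p. F p s)"
    and bound: "\<And>s. s \<in> {0..1} \<Longrightarrow> (LINT p|lborel. \<bar>F p s\<bar>) \<le> C"
  shows "(LINT p|lborel. (LINT s:{0..1}|lborel. F p s)) = (LINT s:{0..1}|lborel. (LINT p|lborel. F p s))"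
proof -
  have [measurable]: "case_prod F \<in> borel_measurable (lborel \<Otimes>\<^sub>M lborel)"
    using meas by (simp add: lborel_prod borel_prod)
  define f where "f s p = indicator {0..1} s * F p s" for s p
  have fm[measurable]: "case_prod f \<in> borel_measurable (lborel \<Otimes>\<^sub>M lborel)"
    unfolding f_def by measurable
  have int_f: "integrable lborel (f s)" for s
    using int[of s] by (cases "s \<in> {0..1}") (auto simp: f_def[abs_def])
  have "integrable (lborel \<Otimes>\<^sub>M lborel) (case_prod f)"
  proof (rule lborel_pair.Fubini_integrable[OF fm])
    show "AE s in lborel. integrable lborel (\<lambda>p. case_prod f (s, p))"
      using int_f by simp
    show "integrable lborel (\<lambda>s. (LINT p|lborel. norm (case_prod f (s, p))))"
    proof (rule Bochner_Integration.integrable_bound)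
      show "integrable lborel (\<lambda>s::real. indicator {0..1} s * \<bar>C\<bar>)"
        by (intro integrable_mult_left integrable_real_indicator) auto
      show "AE s in lborel. norm (LINT p|lborel. norm (case_prod f (s, p))) \<le> norm (indicator {0..1} s * \<bar>C\<bar>)"
      proof (rule AE_I2)
        fix s :: real
        have "0 \<le> (LINT p|lborel. \<bar>F p s\<bar>)" by (rule integral_nonneg_AE) auto
        then show "norm (LINT p|lborel. norm (case_prod f (s, p))) \<le> norm (indicator {0..1} s * \<bar>C\<bar>)"
          using bound[of s] by (cases "s \<in> {0..1}") (auto simp: f_def abs_mult)
      qed
    qed measurable
  qed
  then have "(LINT p|lborel. (LINT s|lborel. f s p)) = (LINT s|lborel. (LINT p|lborel. f s p))"
    by (rule lborel_pair.Fubini_integral)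
  then show ?thesis
    by (simp add: f_def set_lebesgue_integral_def)
qed

text \<open>Averaging over segments is self-adjoint up to reversing the segment: exchange the integrals and translate.\<close>

lemma integral_segment_adjoint:
  fixes v \<psi> :: "'a::euclidean_space \<Rightarrow> real"
  assumes v: "integrable lborel v"
    and \<psi>: "\<psi> \<in> borel_measurable borel" "\<And>p. \<bar>\<psi> p\<bar> \<le> B"
  shows "(LINT p|lborel. v p * (LINT s:{0..1}|lborel. \<psi> (p + s *\<^sub>R a))) =
         (LINT p|lborel. \<psi> p * (LINT s:{0..1}|lborel. v (p - s *\<^sub>R a)))"
proof -
  note [measurable] = \<psi>(1)
  have [measurable]: "v \<in> borel_measurable borel"
    using borel_measurable_integrable[OF v] by simp
  have B: "0 \<le> B" using \<psi>(2)[of 0] by linarith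
  have int_shift: "integrable lborel (\<lambda>p. v (p + b))" for b
    by (rule lborel_integrable_shift[OF v])
  have abs_shift: "(LINT p|lborel. \<bar>v (p + b)\<bar>) = (LINT p|lborel. \<bar>v p\<bar>)" for b
    by (rule lborel_integral_shift) measurable
  have int1: "integrable lborel (\<lambda>p. v (p + b) * \<psi> (p + c))" for b c
    by (rule integrable_mult_bounded[OF int_shift _ \<psi>(2)]) measurable
  have bd1: "(LINT p|lborel. \<bar>v (p + b) * \<psi> (p + c)\<bar>) \<le> B * (LINT p|lborel. \<bar>v p\<bar>)" for b c
  proof -
    have "(LINT p|lborel. \<bar>v (p + b) * \<psi> (p + c)\<bar>) \<le> (LINT p|lborel. B * \<bar>v (p + b)\<bar>)"
      using \<psi>(2) by (intro integral_mono integrable_abs int1 integrable_mult_right int_shift)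
        (auto simp: abs_mult mult.commute[of B] intro!: mult_left_mono)
    then show ?thesis using abs_shift[of b] by simp
  qed
  have "(LINT p|lborel. v p * (LINT s:{0..1}|lborel. \<psi> (p + s *\<^sub>R a))) =
      (LINT p|lborel. (LINT s:{0..1}|lborel. v p * \<psi> (p + s *\<^sub>R a)))"
    by simp
  also have "\<dots> = (LINT s:{0..1}|lborel. (LINT p|lborel. v p * \<psi> (p + s *\<^sub>R a)))"
    using int1[of 0] bd1[of 0] by (intro integral_segment_commute) (measurable, simp_all)
  also have "\<dots> = (LINT s:{0..1}|lborel. (LINT p|lborel. \<psi> p * v (p - s *\<^sub>R a)))"
  proof (intro set_lebesgue_integral_cong)
    show "\<forall>s. s \<in> {0..1} \<longrightarrow>
        (LINT p|lborel. v p * \<psi> (p + s *\<^sub>R a)) = (LINT p|lborel. \<psi> p * v (p - s *\<^sub>R a))"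
    proof (intro allI impI)
      fix s
      show "(LINT p|lborel. v p * \<psi> (p + s *\<^sub>R a)) = (LINT p|lborel. \<psi> p * v (p - s *\<^sub>R a))"
        using lborel_integral_shift[of "\<lambda>p. \<psi> p * v (p - s *\<^sub>R a)" "s *\<^sub>R a"]
        by (simp add: mult.commute)
    qed
  qed simp
  also have "\<dots> = (LINT p|lborel. (LINT s:{0..1}|lborel. \<psi> p * v (p - s *\<^sub>R a)))"
    using int1[of _ 0] bd1[of _ 0]
    by (intro integral_segment_commute[symmetric])
       (measurable, simp_all add: mult.commute diff_conv_add_uminus del: add_uminus_conv_diff)
  finally show ?thesis by simp
qed

text \<open>Bounded convergence almost everywhere with a common compact support gives \<open>L\<^sup>1\<close> convergence. The approximants
  provided by measurability are truncated to \<open>[-B, B]\<close> and multiplied by a continuous cutoff that is \<open>1\<close> on \<open>K\<close>.\<close>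

lemma approximate_by_continuous:
  fixes H :: "'a::euclidean_space \<Rightarrow> real"
  assumes H: "H \<in> borel_measurable borel" "\<And>p. \<bar>H p\<bar> \<le> B" "compact K" "\<And>p. p \<notin> K \<Longrightarrow> H p = 0"
  obtains c K' where "\<And>n. continuous_on UNIV (c n)" "\<And>n p. \<bar>c n p\<bar> \<le> B"
    "compact K'" "\<And>n p. p \<notin> K' \<Longrightarrow> c n p = 0" "AE p in lborel. (\<lambda>n::nat. c n p) \<longlonglongrightarrow> H p"
proof -
  \<comment> \<open>A nonempty support makes the distance to it meaningful.\<close>
  define K1 where "K1 = insert 0 K"
  have K1: "compact K1" "K1 \<noteq> {}" "\<And>p. p \<notin> K1 \<Longrightarrow> H p = 0"
    using H by (auto simp: K1_def compact_insert)
  have B: "0 \<le> B" using H(2)[of 0] by linarith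
  have "H measurable_on UNIV"
    using H(1) by (intro lebesgue_measurable_imp_measurable_on_real) (auto simp: measurable_completion)
  then obtain N g where N: "negligible N" and g: "\<And>n::nat. continuous_on UNIV (g n)"
    and lim: "\<And>x. x \<notin> N \<Longrightarrow> (\<lambda>n. g n x) \<longlonglongrightarrow> H x"
    unfolding measurable_on_def by auto
  define c where "c n p = max (-B) (min B (g n p)) * max 0 (1 - infdist p K1)" for n p
  have 1: "\<bar>max (-B) (min B y)\<bar> \<le> B" for y :: real using B by auto
  have 2: "\<bar>max 0 (1 - infdist p K1)\<bar> \<le> 1" for p by (auto simp: infdist_nonneg)
  show ?thesis
  proof (rule that[of c "{p. infdist p K1 \<le> 1}"])
    show "continuous_on UNIV (c n)" for n
      unfolding c_def by (intro continuous_intros g continuous_on_max continuous_on_min continuous_on_infdist)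
    show "\<bar>c n p\<bar> \<le> B" for n p
      using mult_mono[OF 1[of "g n p"] 2[of p]] B by (simp add: c_def abs_mult)
    show "compact {p. infdist p K1 \<le> 1}"
      by (rule compact_infdist_le) (use K1 in auto)
    show "c n p = 0" if "p \<notin> {p. infdist p K1 \<le> 1}" for n p
      using that by (auto simp: c_def)
    have "AE p in lebesgue. p \<notin> N"
      using N by (intro AE_not_in) (simp add: negligible_iff_null_sets)
    then have "AE p in lborel. p \<notin> N" by (simp add: AE_completion_iff)
    then show "AE p in lborel. (\<lambda>n::nat. c n p) \<longlonglongrightarrow> H p"
    proof (rule AE_mp[OF _ AE_I2[OF impI]])
      fix p assume "p \<notin> N"
      have "(\<lambda>n. c n p) \<longlonglongrightarrow> max (-B) (min B (H p)) * max 0 (1 - infdist p K1)"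
        unfolding c_def by (intro tendsto_intros lim \<open>p \<notin> N\<close> tendsto_max tendsto_min)
      moreover have "max (-B) (min B (H p)) * max 0 (1 - infdist p K1) = H p"
        using H(2)[of p] K1 B by (cases "p \<in> K1") (auto simp: abs_le_iff)
      ultimately show "(\<lambda>n. c n p) \<longlonglongrightarrow> H p" by simp
    qed
  qed
qed

text \<open>By the Stone-Weierstrass theorem \<open>H\<close> is orthogonal to all continuous functions, hence to continuous functions
  converging to \<open>H\<close> itself, and so \<open>\<integral> H\<^sup>2 = 0\<close>.\<close>

lemma AE_zero_if_orthogonal_to_polynomials:
  fixes H :: "'a::euclidean_space \<Rightarrow> real"
  assumes H: "H \<in> borel_measurable borel" "\<And>p. \<bar>H p\<bar> \<le> B" "compact K" "\<And>p. p \<notin> K \<Longrightarrow> H p = 0"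
    and orth: "\<And>P. real_polynomial_function P \<Longrightarrow> (LINT p|lborel. H p * P p) = 0"
  shows "AE p in lborel. H p = 0"
proof -
  note [measurable] = H(1)
  have cont_meas: "c \<in> borel_measurable borel" if "continuous_on UNIV c" for c :: "'a \<Rightarrow> real"
    using that by (rule borel_measurable_continuous_onI)
  have int: "integrable lborel (\<lambda>p. H p * c p)" if c: "continuous_on UNIV c" for c
  proof -
    have "bounded (c ` K)"
      by (intro compact_imp_bounded compact_continuous_image H(3) continuous_on_subset[OF c]) auto
    then obtain C where C: "\<And>p. p \<in> K \<Longrightarrow> \<bar>c p\<bar> \<le> C" unfolding bounded_iff by auto
    have "\<bar>H p * c p\<bar> \<le> B * \<bar>C\<bar>" for p
    proof (cases "p \<in> K")
      case True
      then show ?thesis unfolding abs_mult using H(2)[of p] C[of p]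
        by (intro mult_mono) auto
    next
      case False
      have "0 \<le> B" using H(2)[of p] by linarith
      then show ?thesis using False H(4) by simp
    qed
    then show ?thesis
      using cont_meas[OF c] H(3,4) by (intro integrable_bounded_compact_support[where K=K]) auto
  qed
  have intH: "integrable lborel H" by (rule integrable_bounded_compact_support[OF H])
  have zero: "(LINT p|lborel. H p * c p) = 0" if c: "continuous_on UNIV c" for c
  proof -
    have le: "\<bar>LINT p|lborel. H p * c p\<bar> \<le> e * (LINT p|lborel. \<bar>H p\<bar>)" if "0 < e" for e
    proof -
      obtain P where P: "polynomial_function P" and approx: "\<And>p. p \<in> K \<Longrightarrow> norm (c p - P p) < e"
        using Stone_Weierstrass_polynomial_function[OF H(3) continuous_on_subset[OF c] \<open>0 < e\<close>] by blast
      have P': "real_polynomial_function P" using P by (simp add: real_polynomial_function_eq)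
      have contP: "continuous_on UNIV P" by (rule continuous_on_polymonial_function[OF P])
      have "(LINT p|lborel. H p * c p) = (LINT p|lborel. H p * c p) - (LINT p|lborel. H p * P p)"
        by (simp add: orth[OF P'])
      also have "\<dots> = (LINT p|lborel. H p * c p - H p * P p)"
        by (rule Bochner_Integration.integral_diff[symmetric]) (intro int c contP)+
      finally have "\<bar>LINT p|lborel. H p * c p\<bar> \<le> (LINT p|lborel. \<bar>H p * c p - H p * P p\<bar>)"
        by (simp add: integral_abs_bound)
      also have "\<dots> \<le> (LINT p|lborel. e * \<bar>H p\<bar>)"
      proof (rule integral_mono)
        show "integrable lborel (\<lambda>p. \<bar>H p * c p - H p * P p\<bar>)"
          by (intro integrable_abs Bochner_Integration.integrable_diff int c contP)
        show "integrable lborel (\<lambda>p. e * \<bar>H p\<bar>)"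
          by (intro integrable_mult_right integrable_abs intH)
        show "\<bar>H p * c p - H p * P p\<bar> \<le> e * \<bar>H p\<bar>" for p
        proof (cases "p \<in> K")
          case True
          have "\<bar>H p\<bar> * \<bar>c p - P p\<bar> \<le> \<bar>H p\<bar> * e"
            using approx[OF True] by (intro mult_left_mono) auto
          then show ?thesis by (simp add: right_diff_distrib[symmetric] abs_mult mult.commute)
        qed (simp add: H(4))
      qed
      finally show ?thesis by simp
    qed
    have "\<bar>LINT p|lborel. H p * c p\<bar> \<le> 0 + e" if "0 < e" for e
    proof -
      define I where "I = (LINT p|lborel. \<bar>H p\<bar>)"
      have "0 \<le> I" unfolding I_def by (rule integral_nonneg_AE) auto
      have "\<bar>LINT p|lborel. H p * c p\<bar> \<le> e / (I + 1) * I"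
        using le[of "e / (I + 1)", folded I_def] \<open>0 < e\<close> \<open>0 \<le> I\<close> by simp
      also have "\<dots> \<le> e" using \<open>0 < e\<close> \<open>0 \<le> I\<close> by (simp add: field_simps)
      finally show ?thesis by simp
    qed
    then have "\<bar>LINT p|lborel. H p * c p\<bar> \<le> 0" by (rule field_le_epsilon)
    then show ?thesis by simp
  qed
  obtain c K' where c: "\<And>n. continuous_on UNIV (c n)" "\<And>n p. \<bar>c n p\<bar> \<le> B"
    "compact K'" "\<And>n p. p \<notin> K' \<Longrightarrow> c n p = 0" "AE p in lborel. (\<lambda>n::nat. c n p) \<longlonglongrightarrow> H p"
    by (rule approximate_by_continuous[OF H]) blast+
  have "(\<lambda>n. (LINT p|lborel. H p * c n p)) \<longlonglongrightarrow> (LINT p|lborel. H p * H p)"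
  proof (rule integral_dominated_convergence)
    show "integrable lborel (\<lambda>p. B * \<bar>H p\<bar>)" by (intro integrable_mult_right integrable_abs intH)
    show "AE p in lborel. (\<lambda>n. H p * c n p) \<longlonglongrightarrow> H p * H p"
      using c(5) by eventually_elim (intro tendsto_intros)
    show "AE p in lborel. norm (H p * c n p) \<le> B * \<bar>H p\<bar>" for n
      using c(2)[of n] by (intro AE_I2) (simp add: abs_mult mult.commute[of B] mult_left_mono)
  qed (use cont_meas[OF c(1)] in auto)
  then have sq: "(LINT p|lborel. H p * H p) = 0"
    by (simp add: zero[OF c(1)] LIMSEQ_const_iff)
  have "integrable lborel (\<lambda>p. H p * H p)"
    by (rule integrable_mult_bounded[OF intH H(1,2)])
  then have "AE p in lborel. H p * H p = 0"
    using sq by (subst (asm) integral_nonneg_eq_0_iff_AE) auto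
  then show ?thesis by simp
qed

text \<open>Translation is continuous in \<open>L\<^sup>1\<close>, in the form of pairings with a bounded function \<open>v\<close>. The function \<open>v\<close> has
  no regularity, so the shift must be moved to the other factor, where it is harmless for a continuous function;
  \<open>H\<close> is approximated by such functions, uniformly in the shift.\<close>

lemma pairing_shift_tendsto:
  fixes H v :: "'a::euclidean_space \<Rightarrow> real"
  assumes H: "H \<in> borel_measurable borel" "\<And>p. \<bar>H p\<bar> \<le> B" "compact K" "\<And>p. p \<notin> K \<Longrightarrow> H p = 0"
    and v: "v \<in> borel_measurable borel" "\<And>p. \<bar>v p\<bar> \<le> V"
    and a: "a \<longlonglongrightarrow> 0"
  shows "(\<lambda>k::nat. (LINT p|lborel. H p * v (p + a k))) \<longlonglongrightarrow> (LINT p|lborel. H p * v p)"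
proof -
  note [measurable] = H(1) v(1)
  have V: "0 \<le> V" using v(2)[of 0] by linarith
  have B: "0 \<le> B" using H(2)[of 0] by linarith
  obtain c K' where c: "\<And>n. continuous_on UNIV (c n)" "\<And>n p. \<bar>c n p\<bar> \<le> B"
    "compact K'" "\<And>n p. p \<notin> K' \<Longrightarrow> c n p = 0" "AE p in lborel. (\<lambda>n::nat. c n p) \<longlonglongrightarrow> H p"
    by (rule approximate_by_continuous[OF H]) blast+
  have cm[measurable]: "c n \<in> borel_measurable borel" for n
    by (rule borel_measurable_continuous_onI[OF c(1)])
  have intH: "integrable lborel H" by (rule integrable_bounded_compact_support[OF H])
  have intc: "integrable lborel (c n)" for n
    by (rule integrable_bounded_compact_support[OF cm c(2) c(3) c(4)])
  have int_v: "integrable lborel (\<lambda>p. f p * v (p + b))" if "integrable lborel f" for f b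
    by (rule integrable_mult_bounded[OF that _ v(2)]) measurable
  \<comment> \<open>For the continuous approximations the shift can be moved to the other factor.\<close>
  have lim_c: "(\<lambda>k. (LINT p|lborel. c n p * v (p + a k))) \<longlonglongrightarrow> (LINT p|lborel. c n p * v p)" for n
  proof -
    obtain R where R: "\<And>k. norm (a k) \<le> R"
      using convergent_imp_Bseq[of a] a unfolding convergent_def Bseq_def by blast
    define K2 where "K2 = {x + y | x y. x \<in> K' \<and> y \<in> cball 0 R}"
    have K2: "compact K2" unfolding K2_def by (intro compact_sums c compact_cball)
    have "(LINT p|lborel. c n p * v (p + a k)) = (LINT p|lborel. c n (p - a k) * v p)" for k
      using lborel_integral_shift[of "\<lambda>p. c n (p - a k) * v p" "a k"] by simp
    moreover have "(\<lambda>k. (LINT p|lborel. c n (p - a k) * v p)) \<longlonglongrightarrow> (LINT p|lborel. c n p * v p)"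
    proof (rule integral_dominated_convergence)
      show "integrable lborel (\<lambda>p. indicator K2 p * (B * V))"
        using K2 emeasure_compact_finite[OF K2]
        by (intro integrable_mult_left integrable_real_indicator) (auto simp: compact_imp_closed borel_closed)
      show "AE p in lborel. (\<lambda>k. c n (p - a k) * v p) \<longlonglongrightarrow> c n p * v p"
      proof (rule AE_I2)
        fix p
        have "(\<lambda>k. p - a k) \<longlonglongrightarrow> p - 0" by (intro tendsto_intros a)
        then have "(\<lambda>k. c n (p - a k)) \<longlonglongrightarrow> c n p"
          using c(1)[of n] isCont_tendsto_compose[of p "c n"]
          by (simp add: continuous_on_eq_continuous_at)
        then show "(\<lambda>k. c n (p - a k) * v p) \<longlonglongrightarrow> c n p * v p" by (intro tendsto_intros)
      qed
      show "AE p in lborel. norm (c n (p - a k) * v p) \<le> indicator K2 p * (B * V)" for k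
      proof (rule AE_I2)
        fix p
        show "norm (c n (p - a k) * v p) \<le> indicator K2 p * (B * V)"
        proof (cases "p \<in> K2")
          case True
          then show ?thesis using c(2)[of n "p - a k"] v(2)[of p] B V
            by (simp add: abs_mult mult_mono)
        next
          case False
          have "p - a k \<notin> K'"
          proof
            assume "p - a k \<in> K'"
            moreover have "p = (p - a k) + a k" "a k \<in> cball 0 R" using R by auto
            ultimately have "p \<in> K2" unfolding K2_def by blast
            with False show False by simp
          qed
          then show ?thesis using c(4) False by simp
        qed
      qed
    qed auto
    ultimately show ?thesis by simp
  qed
  have "(\<lambda>n. (LINT p|lborel. \<bar>H p - c n p\<bar>)) \<longlonglongrightarrow> integral\<^sup>L lborel (\<lambda>p::'a. 0)"
  proof (rule integral_dominated_convergence)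
    show "integrable lborel (\<lambda>p. \<bar>H p\<bar> + indicator K' p * B)"
      using c(3) emeasure_compact_finite[OF c(3)]
      by (intro Bochner_Integration.integrable_add integrable_abs intH integrable_mult_left integrable_real_indicator)
         (auto simp: compact_imp_closed borel_closed)
    show "AE p in lborel. (\<lambda>n. \<bar>H p - c n p\<bar>) \<longlonglongrightarrow> 0"
      using c(5) by eventually_elim (auto intro!: tendsto_eq_intros)
    show "AE p in lborel. norm \<bar>H p - c n p\<bar> \<le> \<bar>H p\<bar> + indicator K' p * B" for n
    proof (rule AE_I2)
      fix p show "norm \<bar>H p - c n p\<bar> \<le> \<bar>H p\<bar> + indicator K' p * B"
        using c(2)[of n p] c(4)[of p n] by (cases "p \<in> K'") auto
    qed
  qed auto
  then have L1: "(\<lambda>n. (LINT p|lborel. \<bar>H p - c n p\<bar>)) \<longlonglongrightarrow> 0" by simp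
  have diff: "\<bar>(LINT p|lborel. H p * v (p + b)) - (LINT p|lborel. c n p * v (p + b))\<bar>
      \<le> V * (LINT p|lborel. \<bar>H p - c n p\<bar>)" for n b
  proof -
    have i: "integrable lborel (\<lambda>p. (H p - c n p) * v (p + b))"
      by (intro int_v Bochner_Integration.integrable_diff intH intc)
    have "(LINT p|lborel. H p * v (p + b)) - (LINT p|lborel. c n p * v (p + b)) =
        (LINT p|lborel. (H p - c n p) * v (p + b))"
      by (simp add: left_diff_distrib Bochner_Integration.integral_diff int_v intH intc)
    then have "\<bar>(LINT p|lborel. H p * v (p + b)) - (LINT p|lborel. c n p * v (p + b))\<bar>
        \<le> (LINT p|lborel. \<bar>(H p - c n p) * v (p + b)\<bar>)"
      by (simp add: integral_abs_bound)
    also have "\<dots> \<le> (LINT p|lborel. V * \<bar>H p - c n p\<bar>)"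
      using v(2) i by (intro integral_mono integrable_mult_right integrable_abs
          Bochner_Integration.integrable_diff intH intc)
        (auto simp: abs_mult mult.commute[of V] intro!: mult_left_mono)
    finally show ?thesis by simp
  qed
  show ?thesis
  proof (rule LIMSEQ_I)
    fix r :: real assume "0 < r"
    have "0 < r / (3 * (V + 1))" using \<open>0 < r\<close> V by simp
    then obtain n where n: "(LINT p|lborel. \<bar>H p - c n p\<bar>) < r / (3 * (V + 1))"
      using LIMSEQ_D[OF L1, of "r / (3 * (V + 1))"] by fastforce
    have "V * (LINT p|lborel. \<bar>H p - c n p\<bar>) \<le> V * (r / (3 * (V + 1)))"
      using n V by (intro mult_left_mono) auto
    also have "\<dots> \<le> r / 3" using V \<open>0 < r\<close> by (simp add: field_simps)
    finally have small: "V * (LINT p|lborel. \<bar>H p - c n p\<bar>) \<le> r / 3" .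
    obtain k0 where k0: "\<And>k. k0 \<le> k \<Longrightarrow>
        norm ((LINT p|lborel. c n p * v (p + a k)) - (LINT p|lborel. c n p * v p)) < r / 3"
      using LIMSEQ_D[OF lim_c[of n], of "r / 3"] \<open>0 < r\<close> by auto
    show "\<exists>k0. \<forall>k\<ge>k0. norm ((LINT p|lborel. H p * v (p + a k)) - (LINT p|lborel. H p * v p)) < r"
    proof (intro exI allI impI)
      fix k assume "k0 \<le> k"
      then show "norm ((LINT p|lborel. H p * v (p + a k)) - (LINT p|lborel. H p * v p)) < r"
        using k0[of k] diff[of "a k" n] diff[of 0 n, simplified] small
        unfolding real_norm_def by linarith
    qed
  qed
qed

lemma pairing_segment_average_tendsto:
  fixes H v :: "'a::euclidean_space \<Rightarrow> real"
  assumes H: "H \<in> borel_measurable borel" "\<And>p. \<bar>H p\<bar> \<le> B" "compact K" "\<And>p. p \<notin> K \<Longrightarrow> H p = 0"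
    and v: "v \<in> borel_measurable borel" "\<And>p. \<bar>v p\<bar> \<le> V"
    and a: "a \<longlonglongrightarrow> 0"
  shows "(\<lambda>k::nat. (LINT p|lborel. H p * (LINT s:{0..1}|lborel. v (p + s *\<^sub>R a k))))
    \<longlonglongrightarrow> (LINT p|lborel. H p * v p)"
proof -
  note [measurable] = H(1) v(1)
  have V: "0 \<le> V" using v(2)[of 0] by linarith
  have intH: "integrable lborel H" by (rule integrable_bounded_compact_support[OF H])
  have int_v: "integrable lborel (\<lambda>p. H p * v (p + b))" for b
    by (rule integrable_mult_bounded[OF intH _ v(2)]) measurable
  have bd: "(LINT p|lborel. \<bar>H p * v (p + b)\<bar>) \<le> V * (LINT p|lborel. \<bar>H p\<bar>)" for b
  proof -
    have "(LINT p|lborel. \<bar>H p * v (p + b)\<bar>) \<le> (LINT p|lborel. V * \<bar>H p\<bar>)"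
      using v(2) by (intro integral_mono integrable_mult_right integrable_abs int_v intH)
        (auto simp: abs_mult mult.commute[of V] intro!: mult_left_mono)
    then show ?thesis by simp
  qed
  define J where "J b = (LINT p|lborel. H p * v (p + b))" for b
  have Jbd: "\<bar>J b\<bar> \<le> V * (LINT p|lborel. \<bar>H p\<bar>)" for b
    unfolding J_def by (rule order_trans[OF integral_abs_bound bd])
  have J_meas[measurable]: "J \<in> borel_measurable borel"
    unfolding J_def by measurable
  have eq: "(LINT p|lborel. H p * (LINT s:{0..1}|lborel. v (p + s *\<^sub>R a k))) =
      (LINT s:{0..1}|lborel. J (s *\<^sub>R a k))" for k
  proof -
    have "(LINT p|lborel. H p * (LINT s:{0..1}|lborel. v (p + s *\<^sub>R a k))) =
        (LINT p|lborel. (LINT s:{0..1}|lborel. H p * v (p + s *\<^sub>R a k)))"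
      by simp
    also have "\<dots> = (LINT s:{0..1}|lborel. (LINT p|lborel. H p * v (p + s *\<^sub>R a k)))"
      using int_v bd by (intro integral_segment_commute) (measurable, simp_all)
    finally show ?thesis by (simp add: J_def)
  qed
  have "(\<lambda>k. (LINT s|lborel. indicator {0..1} s *\<^sub>R J (s *\<^sub>R a k))) \<longlonglongrightarrow>
      (LINT s|lborel. indicator {0..1::real} s *\<^sub>R J 0)"
  proof (rule integral_dominated_convergence)
    show "integrable lborel (\<lambda>s::real. indicator {0..1} s * (V * (LINT p|lborel. \<bar>H p\<bar>)))"
      by (intro integrable_mult_left integrable_real_indicator) auto
    show "AE s in lborel. (\<lambda>k. indicator {0..1::real} s *\<^sub>R J (s *\<^sub>R a k)) \<longlonglongrightarrow> indicator {0..1} s *\<^sub>R J 0"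
    proof (rule AE_I2)
      fix s :: real
      have "(\<lambda>k. s *\<^sub>R a k) \<longlonglongrightarrow> s *\<^sub>R 0" by (intro tendsto_intros a)
      then have "(\<lambda>k. J (s *\<^sub>R a k)) \<longlonglongrightarrow> J 0"
        unfolding J_def using pairing_shift_tendsto[OF H v, of "\<lambda>k. s *\<^sub>R a k"] by simp
      then show "(\<lambda>k. indicator {0..1::real} s *\<^sub>R J (s *\<^sub>R a k)) \<longlonglongrightarrow> indicator {0..1} s *\<^sub>R J 0"
        by (intro tendsto_intros)
    qed
    show "AE s in lborel. norm (indicator {0..1::real} s *\<^sub>R J (s *\<^sub>R a k))
        \<le> indicator {0..1} s * (V * (LINT p|lborel. \<bar>H p\<bar>))" for k
      using Jbd by (auto split: split_indicator)
  qed measurable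
  moreover have "(LINT s|lborel. indicator {0..1::real} s *\<^sub>R J 0) = J 0"
    by simp
  ultimately show ?thesis
    unfolding eq by (simp add: set_lebesgue_integral_def J_def)
qed

section \<open>Weak derivatives in terms of Borel representatives\<close>

lemma segment_integral_bound:
  fixes v :: "'a::euclidean_space \<Rightarrow> real"
  assumes "v \<in> borel_measurable borel" "\<And>p. \<bar>v p\<bar> \<le> V"
  shows "\<bar>LINT s:{0..1}|lborel. v (p + s *\<^sub>R a)\<bar> \<le> V"
proof -
  note [measurable] = assms(1)
  have int: "integrable lborel (\<lambda>s::real. indicator {0..1} s * V)"
    by (intro integrable_mult_left integrable_real_indicator) auto
  have "norm (LINT s|lborel. indicator {0..1::real} s *\<^sub>R v (p + s *\<^sub>R a))
      \<le> (LINT s|lborel. indicator {0..1::real} s * V)"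
  proof (rule Bochner_Integration.integral_norm_bound_integral[OF _ int])
    show "integrable lborel (\<lambda>s. indicator {0..1::real} s *\<^sub>R v (p + s *\<^sub>R a))"
    proof (rule Bochner_Integration.integrable_bound[OF int])
      show "AE s in lborel. norm (indicator {0..1::real} s *\<^sub>R v (p + s *\<^sub>R a)) \<le> norm (indicator {0..1} s * V)"
        by (intro AE_I2) (auto split: split_indicator intro: order_trans[OF assms(2) abs_ge_self])
    qed measurable
    show "norm (indicator {0..1::real} s *\<^sub>R v (p + s *\<^sub>R a)) \<le> indicator {0..1} s * V" for s
      using assms(2) by (auto split: split_indicator)
  qed
  then show ?thesis by (simp add: set_lebesgue_integral_def)
qed

lemma segment_integral_measurable:
  fixes v :: "'a::euclidean_space \<Rightarrow> real"
  assumes [measurable]: "v \<in> borel_measurable borel"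
  shows "(\<lambda>p. (LINT s:{0..1}|lborel. v (p + s *\<^sub>R a))) \<in> borel_measurable borel"
  unfolding set_lebesgue_integral_def by measurable

text \<open>The identity in \<open>has_weak_derivative\<close> for functions on the whole space. Test functions vanish off \<open>S\<close>, so values of
  \<open>U\<close> and \<open>V\<close> there do not matter; leaving them unconstrained lets \<open>U\<close> be composed with arbitrary functions.\<close>

definition distributional_derivative ::
  "'a::euclidean_space set \<Rightarrow> ('a \<Rightarrow> real) \<Rightarrow> 'a \<Rightarrow> ('a \<Rightarrow> real) \<Rightarrow> bool" where
  "distributional_derivative S U e V \<longleftrightarrow> (\<forall>\<phi>\<in>test_functions S.
     (LINT p|lborel. U p * frechet_derivative \<phi> (at p) e) = - (LINT p|lborel. V p * \<phi> p))"

definition borel_version :: "'a::euclidean_space set \<Rightarrow> ('a \<Rightarrow> real) \<Rightarrow> ('a \<Rightarrow> real) \<Rightarrow> bool" where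
  "borel_version S u U \<longleftrightarrow> U \<in> borel_measurable borel \<and> (AE p in lebesgue. p \<in> S \<longrightarrow> U p = u p)"

text \<open>Completeness of Lebesgue measure is what makes this true.\<close>

lemma lebesgue_measurable_cong_AE:
  fixes u U :: "'a::euclidean_space \<Rightarrow> real"
  assumes U: "U \<in> borel_measurable lebesgue" and eq: "AE p in lebesgue. U p = u p"
  shows "u \<in> borel_measurable lebesgue"
proof (rule measurableI)
  fix A :: "real set" assume A: "A \<in> sets borel"
  show "u -` A \<inter> space lebesgue \<in> sets lebesgue"
  proof (rule completion.in_sets_AE)
    show "U -` A \<inter> space lebesgue \<in> sets lebesgue" using U A by (rule measurable_sets)
    show "AE p in lebesgue. (p \<in> U -` A \<inter> space lebesgue) = (p \<in> u -` A \<inter> space lebesgue)"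
      using eq by eventually_elim auto
  qed auto
qed simp

lemma borel_version_times_indicator:
  assumes u: "borel_version S u U" and S: "S \<in> sets borel"
  shows "AE p in lebesgue. indicator S p * U p = indicator S p * u p"
    and "(\<lambda>p. indicator S p * u p) \<in> borel_measurable lebesgue"
proof -
  have "AE p in lebesgue. p \<in> S \<longrightarrow> U p = u p" using u by (simp add: borel_version_def)
  then show eq: "AE p in lebesgue. indicator S p * U p = indicator S p * u p"
    by eventually_elim (auto simp: indicator_def)
  show "(\<lambda>p. indicator S p * u p) \<in> borel_measurable lebesgue"
    by (rule lebesgue_measurable_cong_AE[OF _ eq])
       (use u S in \<open>auto simp: borel_version_def measurable_completion\<close>)
qed

lemma borel_version_set_integral:
  assumes u: "borel_version S u U" and S: "S \<in> sets borel" and U0: "\<And>p. p \<notin> S \<Longrightarrow> U p = 0"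
  shows "(LINT p:S|lebesgue. u p) = (LINT p|lborel. U p)"
proof -
  have U[measurable]: "U \<in> borel_measurable borel" using u by (simp add: borel_version_def)
  have "(LINT p|lborel. U p) = (LINT p|lebesgue. U p)"
    by (rule integral_completion[symmetric]) simp
  also have "\<dots> = (LINT p|lebesgue. indicator S p * u p)"
  proof (rule integral_cong_AE)
    show "U \<in> borel_measurable lebesgue" by (rule measurable_completion) simp
    show "(\<lambda>p. indicator S p * u p) \<in> borel_measurable lebesgue"
      by (rule borel_version_times_indicator(2)[OF u S])
    show "AE p in lebesgue. U p = indicator S p * u p"
      using borel_version_times_indicator(1)[OF u S]
      by eventually_elim (use U0 in \<open>auto split: split_indicator_asm\<close>)
  qed
  finally show ?thesis by (simp add: set_lebesgue_integral_def)
qed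

lemma borel_version_locally_integrable:
  assumes u: "borel_version S u U" and S: "S \<in> sets borel" and bd: "\<And>p. \<bar>U p\<bar> \<le> C"
  shows "locally_integrable_on u S"
  unfolding locally_integrable_on_def
proof (intro allI impI)
  fix K assume K: "compact K \<and> K \<subseteq> S"
  have U[measurable]: "U \<in> borel_measurable borel" using u by (simp add: borel_version_def)
  have Kb[measurable]: "K \<in> sets borel" using K by (simp add: compact_imp_closed borel_closed)
  have eq: "AE p in lebesgue. indicator K p * U p = indicator K p *\<^sub>R u p"
    using borel_version_times_indicator(1)[OF u S]
    by eventually_elim (use K in \<open>auto split: split_indicator\<close>)
  have C: "0 \<le> C" using bd[of undefined] by linarith
  have "integrable lborel (\<lambda>p. indicator K p * U p)"
  proof (rule integrable_bounded_compact_support)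
    show "\<bar>indicator K p * U p\<bar> \<le> C" for p using bd[of p] C by (auto split: split_indicator)
  qed (use K in auto)
  then have "integrable lebesgue (\<lambda>p. indicator K p * U p)"
    by (subst integrable_completion) auto
  then show "set_integrable lebesgue K u"
    unfolding set_integrable_def
  proof (rule integrable_cong_AE_imp)
    show "(\<lambda>p. indicator K p *\<^sub>R u p) \<in> borel_measurable lebesgue"
      by (rule lebesgue_measurable_cong_AE[OF _ eq]) (simp add: measurable_completion)
    show "AE p in lebesgue. indicator K p * U p = indicator K p *\<^sub>R u p" by (rule eq)
  qed
qed

lemma test_functions_measurable:
  assumes "\<phi> \<in> test_functions S"
  shows "\<phi> \<in> borel_measurable borel" "(\<lambda>p. frechet_derivative \<phi> (at p) e) \<in> borel_measurable borel"
  using test_functionsD(1)[OF assms]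
  by (intro borel_measurable_continuous_onI Ck_continuous Ck_continuous_frechet; blast)+

lemma has_weak_derivative_iff_borel_version:
  assumes S: "S \<in> sets borel"
    and u: "borel_version S u U" "\<And>p. \<bar>U p\<bar> \<le> C" and v: "borel_version S v V" "\<And>p. \<bar>V p\<bar> \<le> D"
  shows "has_weak_derivative S u e v \<longleftrightarrow> distributional_derivative S U e V"
proof -
  have version: "(LINT p:S|lebesgue. f p * \<psi> p) = (LINT p|lborel. F p * \<psi> p)"
    if "borel_version S f F" "\<psi> \<in> borel_measurable borel" "\<And>p. p \<notin> S \<Longrightarrow> \<psi> p = 0" for f F \<psi>
    using that by (intro borel_version_set_integral S) (auto simp: borel_version_def elim!: eventually_mono)
  have "(LINT p:S|lebesgue. u p * frechet_derivative \<phi> (at p) e) =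
      (LINT p|lborel. U p * frechet_derivative \<phi> (at p) e)"
    "(LINT p:S|lebesgue. v p * \<phi> p) = (LINT p|lborel. V p * \<phi> p)" if \<phi>: "\<phi> \<in> test_functions S" for \<phi>
  proof -
    obtain K where K: "compact K" "K \<subseteq> S" "\<And>p. p \<notin> K \<Longrightarrow> \<phi> p = 0"
      "\<And>p e. p \<notin> K \<Longrightarrow> frechet_derivative \<phi> (at p) e = 0"
      using test_functions_support[OF \<phi>] by blast
    have "\<phi> p = 0" "frechet_derivative \<phi> (at p) e = 0" if "p \<notin> S" for p
      using K(2-4) that by auto
    then show "(LINT p:S|lebesgue. u p * frechet_derivative \<phi> (at p) e) =
        (LINT p|lborel. U p * frechet_derivative \<phi> (at p) e)"
      "(LINT p:S|lebesgue. v p * \<phi> p) = (LINT p|lborel. V p * \<phi> p)"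
      using version[OF u(1) test_functions_measurable(2)[OF \<phi>], of e]
        version[OF v(1) test_functions_measurable(1)[OF \<phi>]] by simp_all
  qed
  then show ?thesis
    unfolding has_weak_derivative_def distributional_derivative_def
    using borel_version_locally_integrable[OF u(1) S u(2)]
      borel_version_locally_integrable[OF v(1) S v(2)] by simp
qed

section \<open>The chain rule\<close>

text \<open>A weak derivative governs increments at almost every point. Let \<open>H\<close> be \<open>\<phi>\<close> times the difference of the two
  sides. For a polynomial \<open>P\<close>, testing with the average of \<open>\<psi> = \<phi> P\<close> over segments gives \<open>\<integral> H P = 0\<close>. The
  factor \<open>\<phi>\<close> stays in the conclusion because it is the cutoff that makes \<open>\<psi>\<close> a test function.\<close>

lemma distributional_increment:
  fixes U V :: "'a::euclidean_space \<Rightarrow> real"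
  assumes DD: "distributional_derivative S U e V"
    and U: "U \<in> borel_measurable borel" "\<And>p. \<bar>U p\<bar> \<le> C"
    and V: "V \<in> borel_measurable borel" "\<And>p. \<bar>V p\<bar> \<le> D"
    and \<phi>: "\<phi> \<in> test_functions S" and K: "compact K" "\<And>p. p \<notin> K \<Longrightarrow> \<phi> p = 0"
    and S: "\<And>p s. p \<in> K \<Longrightarrow> s \<in> {0..1} \<Longrightarrow> p + s *\<^sub>R (h *\<^sub>R e) \<in> S"
  shows "AE p in lborel. \<phi> p * (U (p + h *\<^sub>R e) - U p) =
      \<phi> p * (h * (LINT s:{0..1}|lborel. V (p + s *\<^sub>R (h *\<^sub>R e))))"
proof -
  note [measurable] = U(1) V(1)
  define K' where "K' = (\<lambda>(p, s). p + s *\<^sub>R (h *\<^sub>R e)) ` (K \<times> {0..1::real})"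
  have K': "compact K'"
    unfolding K'_def using K(1)
    by (intro compact_continuous_image compact_Times) (auto simp: split_beta intro!: continuous_intros)
  have [measurable]: "K' \<in> sets borel" using K' by (simp add: compact_imp_closed borel_closed)
  have memK': "p + s *\<^sub>R (h *\<^sub>R e) \<in> K'" if "p \<in> K" "s \<in> {0..1}" for p s
    using that unfolding K'_def by force
  \<comment> \<open>Outside the region swept by the segments \<open>V\<close> may fail to be integrable; it is cut off there.\<close>
  define W where "W p = indicator K' p * V p" for p
  have W_meas[measurable]: "W \<in> borel_measurable borel" unfolding W_def by measurable
  have C: "0 \<le> C" using U(2)[of 0] by linarith
  have D: "0 \<le> D" using V(2)[of 0] by linarith
  have W_bd: "\<bar>W p\<bar> \<le> D" for p
    using V(2)[of p] D by (auto simp: W_def split: split_indicator)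
  have W_int: "integrable lborel W"
    by (rule integrable_bounded_compact_support[OF W_meas W_bd K']) (simp add: W_def)
  define A where "A p = (LINT s:{0..1}|lborel. W (p + s *\<^sub>R (h *\<^sub>R e)))" for p
  have A_meas[measurable]: "A \<in> borel_measurable borel"
    unfolding A_def[abs_def] by (rule segment_integral_measurable[OF W_meas])
  have A_bd: "\<bar>A p\<bar> \<le> D" for p
    unfolding A_def by (rule segment_integral_bound[OF W_meas W_bd])
  have A_eq: "A p = (LINT s:{0..1}|lborel. V (p + s *\<^sub>R (h *\<^sub>R e)))" if "p \<in> K" for p
    unfolding A_def using memK'[OF that] by (intro set_lebesgue_integral_cong) (auto simp: W_def)
  obtain B where B: "0 < B" "\<And>p. \<bar>\<phi> p\<bar> \<le> B"
    using continuous_compact_support_bounded[OF test_functionsD(2)[OF \<phi>] K] by blast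
  note \<phi>_meas[measurable] = test_functions_measurable(1)[OF \<phi>]
  define H where "H p = \<phi> p * (U (p + h *\<^sub>R e) - U p - h * A p)" for p
  have "AE p in lborel. H p = 0"
  proof (rule AE_zero_if_orthogonal_to_polynomials[where K=K and B="B * (2 * C + \<bar>h\<bar> * D)"])
    show "H \<in> borel_measurable borel" unfolding H_def by measurable
    show "compact K" by fact
    show "H p = 0" if "p \<notin> K" for p using K(2)[OF that] by (simp add: H_def)
    show "\<bar>H p\<bar> \<le> B * (2 * C + \<bar>h\<bar> * D)" for p
    proof -
      have "\<bar>h * A p\<bar> \<le> \<bar>h\<bar> * D" using A_bd[of p] by (simp add: abs_mult mult_left_mono)
      then have "\<bar>U (p + h *\<^sub>R e) - U p - h * A p\<bar> \<le> 2 * C + \<bar>h\<bar> * D"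
        using U(2)[of p] U(2)[of "p + h *\<^sub>R e"] by linarith
      then show ?thesis unfolding H_def abs_mult using B C D by (intro mult_mono) auto
    qed
    fix P :: "'a \<Rightarrow> real" assume P: "real_polynomial_function P"
    define \<psi> where "\<psi> p = \<phi> p * P p" for p
    have \<psi>: "\<psi> \<in> test_functions S"
      unfolding \<psi>_def[abs_def] by (rule test_functions_mult_polynomial[OF \<phi> P])
    have \<psi>0: "\<psi> p = 0" if "p \<notin> K" for p using K(2)[OF that] by (simp add: \<psi>_def)
    note \<psi>_meas[measurable] = test_functions_measurable(1)[OF \<psi>]
    obtain B' where B': "\<And>p. \<bar>\<psi> p\<bar> \<le> B'"
      using continuous_compact_support_bounded[OF test_functionsD(2)[OF \<psi>] K(1) \<psi>0] by blast
    have \<psi>_int: "integrable lborel \<psi>"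
      by (rule integrable_bounded_compact_support[OF \<psi>_meas B' K(1) \<psi>0])
    have int: "integrable lborel (\<lambda>p. F p * \<psi> (p + b))"
      if "F \<in> borel_measurable borel" "\<And>p. \<bar>F p\<bar> \<le> c" for F c b
      using integrable_mult_bounded[OF lborel_integrable_shift[OF \<psi>_int, of b] that]
      by (simp add: mult.commute)
    define \<Psi> where "\<Psi> = segment_average (- (h *\<^sub>R e)) \<psi>"
    have \<Psi>: "\<Psi> \<in> test_functions S"
      unfolding \<Psi>_def
    proof (rule test_functions_segment_average[OF \<psi> K(1) \<psi>0])
      show "p - s *\<^sub>R - (h *\<^sub>R e) \<in> S" if "p \<in> K" "s \<in> {0..1}" for p s
        using S[OF that] by simp
    qed
    have \<Psi>_eq: "\<Psi> p = (LINT s:{0..1}|lborel. \<psi> (p + s *\<^sub>R - (h *\<^sub>R e)))" for p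
      unfolding \<Psi>_def by (rule segment_average_lborel[OF test_functionsD(2)[OF \<psi>]])
    have \<Psi>0: "V p * \<Psi> p = W p * \<Psi> p" for p
    proof (cases "p \<in> K'")
      case False
      have "\<psi> (p + s *\<^sub>R - (h *\<^sub>R e)) = 0" if "s \<in> {0..1}" for s
      proof (rule \<psi>0)
        show "p + s *\<^sub>R - (h *\<^sub>R e) \<notin> K"
          using memK'[of "p + s *\<^sub>R - (h *\<^sub>R e)" s] that False by auto
      qed
      then have "\<Psi> p = (LINT s:{0..1::real}|lborel. 0)"
        unfolding \<Psi>_eq by (intro set_lebesgue_integral_cong) auto
      then show ?thesis by (simp add: set_lebesgue_integral_def)
    qed (simp add: W_def)
    have deriv: "h * frechet_derivative \<Psi> (at p) e = \<psi> p - \<psi> (p - h *\<^sub>R e)" for p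
    proof -
      have lin: "linear (frechet_derivative \<Psi> (at p))"
        using test_functionsD(3)[OF \<Psi>] has_derivative_linear by blast
      have "frechet_derivative \<Psi> (at p) (- (h *\<^sub>R e)) = \<psi> (p + - (h *\<^sub>R e)) - \<psi> p"
        unfolding \<Psi>_def frechet_derivative_segment_average[OF test_functionsD(1)[OF \<psi>, of "Suc 0"]]
        by (rule segment_average_increment[OF test_functionsD(1)[OF \<psi>, of "Suc 0"]])
      then show ?thesis
        by (simp add: linear_neg[OF lin] linear_scale[OF lin])
    qed
    have "(LINT p|lborel. H p * P p) =
        (LINT p|lborel. U (p + h *\<^sub>R e) * \<psi> p - U p * \<psi> p - h * (A p * \<psi> p))"
      by (intro Bochner_Integration.integral_cong) (auto simp: H_def \<psi>_def algebra_simps)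
    also have "\<dots> = (LINT p|lborel. U (p + h *\<^sub>R e) * \<psi> p) - (LINT p|lborel. U p * \<psi> p)
        - h * (LINT p|lborel. A p * \<psi> p)"
    proof -
      have "integrable lborel (\<lambda>p. U (p + h *\<^sub>R e) * \<psi> p)" "integrable lborel (\<lambda>p. U p * \<psi> p)"
        "integrable lborel (\<lambda>p. A p * \<psi> p)"
        using int[of "\<lambda>p. U (p + h *\<^sub>R e)" C 0] int[of U C 0] int[of A D 0] U(2) A_bd by auto
      then show ?thesis by simp
    qed
    also have "(LINT p|lborel. U (p + h *\<^sub>R e) * \<psi> p) = (LINT p|lborel. U p * \<psi> (p - h *\<^sub>R e))"
      using lborel_integral_shift[of "\<lambda>p. U p * \<psi> (p - h *\<^sub>R e)" "h *\<^sub>R e"] by simp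
    also have "(LINT p|lborel. A p * \<psi> p) = (LINT p|lborel. V p * \<Psi> p)"
      using integral_segment_adjoint[OF W_int \<psi>_meas B', of "- (h *\<^sub>R e)"]
      unfolding \<Psi>_eq[symmetric] by (simp add: \<Psi>0 A_def mult.commute)
    also have "(LINT p|lborel. V p * \<Psi> p) = - (LINT p|lborel. U p * frechet_derivative \<Psi> (at p) e)"
      using DD \<Psi> by (simp add: distributional_derivative_def)
    also have "h * - (LINT p|lborel. U p * frechet_derivative \<Psi> (at p) e) =
        - (LINT p|lborel. U p * (h * frechet_derivative \<Psi> (at p) e))"
      by (simp add: mult.left_commute)
    also have "\<dots> = - (LINT p|lborel. U p * \<psi> p - U p * \<psi> (p - h *\<^sub>R e))"
      by (simp add: deriv right_diff_distrib)
    also have "\<dots> = (LINT p|lborel. U p * \<psi> (p - h *\<^sub>R e)) - (LINT p|lborel. U p * \<psi> p)"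
      using int[OF U, of 0] int[OF U, of "- (h *\<^sub>R e)"] by simp
    finally show "(LINT p|lborel. H p * P p) = 0" by simp
  qed
  then show ?thesis
  proof (rule AE_mp[OF _ AE_I2[OF impI]])
    fix p assume "H p = 0"
    then show "\<phi> p * (U (p + h *\<^sub>R e) - U p) =
      \<phi> p * (h * (LINT s:{0..1}|lborel. V (p + s *\<^sub>R (h *\<^sub>R e))))"
      using A_eq[of p] K(2)[of p] by (cases "p \<in> K") (auto simp: H_def)
  qed
qed

text \<open>For a test function \<open>\<phi>\<close>, moving a difference quotient from \<open>\<phi>\<close> to \<open>G \<circ> U\<close> shows that \<open>\<integral> G(U) \<partial>\<^sub>e\<phi>\<close> is the
  limit of \<open>- \<integral> \<phi> (G(U(p + h e)) - G(U(p))) / h\<close>. By the mean value theorem and \<open>distributional_increment\<close> the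
  quotient is \<open>G'(z) A\<close>, where \<open>z\<close> is within \<open>h D\<close> of \<open>U(p)\<close> and \<open>A\<close> is the mean of \<open>V\<close> over the
  segment. As \<open>h\<close> tends to \<open>0\<close>, \<open>G'(z)\<close> tends to \<open>G'(U)\<close> pointwise, and \<open>A\<close> tends to \<open>V\<close> weakly,
  which suffices because its partner \<open>\<phi> G'(U)\<close> is fixed.\<close>

lemma distributional_chain_rule:
  fixes U V :: "'a::euclidean_space \<Rightarrow> real" and G G' :: "real \<Rightarrow> real"
  assumes "open S" and DD: "distributional_derivative S U e V"
    and U: "U \<in> borel_measurable borel" "\<And>p. \<bar>U p\<bar> \<le> C"
    and V: "V \<in> borel_measurable borel" "\<And>p. \<bar>V p\<bar> \<le> D"
    and G: "\<And>y. (G has_real_derivative G' y) (at y)" and G': "continuous_on UNIV G'"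
  shows "distributional_derivative S (\<lambda>p. G (U p)) e (\<lambda>p. G' (U p) * V p)"
  unfolding distributional_derivative_def
proof
  fix \<phi> :: "'a \<Rightarrow> real" assume \<phi>: "\<phi> \<in> test_functions S"
  note [measurable] = U(1) V(1)
  have contG: "continuous_on UNIV G"
    using G by (meson DERIV_isCont continuous_at_imp_continuous_on)
  note [measurable] = borel_measurable_continuous_onI[OF contG] borel_measurable_continuous_onI[OF G']
  have C: "0 \<le> C" using U(2)[of 0] by linarith
  have D: "0 \<le> D" using V(2)[of 0] by linarith
  obtain LG where LG: "\<And>y. \<bar>y\<bar> \<le> C \<Longrightarrow> \<bar>G y\<bar> \<le> LG"
    by (rule continuous_bounded_on_interval[OF contG]) blast
  obtain L where L: "\<And>y. \<bar>y\<bar> \<le> C \<Longrightarrow> \<bar>G' y\<bar> \<le> L"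
    by (rule continuous_bounded_on_interval[OF G']) blast
  have L0: "0 \<le> L" using L[of 0] C by auto
  obtain K where K: "compact K" "K \<subseteq> S" "\<And>p. p \<notin> K \<Longrightarrow> \<phi> p = 0"
    "\<And>p e. p \<notin> K \<Longrightarrow> frechet_derivative \<phi> (at p) e = 0"
    using test_functions_support[OF \<phi>] by blast
  note \<phi>_meas[measurable] = test_functions_measurable[OF \<phi>]
  obtain B where B: "0 < B" "\<And>p. \<bar>\<phi> p\<bar> \<le> B"
    using continuous_compact_support_bounded[OF test_functionsD(2)[OF \<phi>] K(1,3)] by blast
  define D\<phi> where "D\<phi> p = frechet_derivative \<phi> (at p) e" for p
  have D\<phi>_cont: "continuous_on UNIV D\<phi>"
    unfolding D\<phi>_def[abs_def] by (rule Ck_continuous_frechet[OF test_functionsD(1)[OF \<phi>]])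
  have D\<phi>_meas[measurable]: "D\<phi> \<in> borel_measurable borel"
    by (rule borel_measurable_continuous_onI[OF D\<phi>_cont])
  have D\<phi>0: "\<And>p. p \<notin> K \<Longrightarrow> D\<phi> p = 0" by (simp add: D\<phi>_def K(4))
  obtain B' where B': "\<And>p. \<bar>D\<phi> p\<bar> \<le> B'"
    using continuous_compact_support_bounded[OF D\<phi>_cont K(1) D\<phi>0] by blast
  have D\<phi>_int: "integrable lborel D\<phi>"
    by (rule integrable_bounded_compact_support[OF D\<phi>_meas B' K(1) D\<phi>0])
  have \<phi>_int: "integrable lborel \<phi>"
    by (rule integrable_bounded_compact_support[OF \<phi>_meas(1) B(2) K(1,3)])
  obtain r where r: "0 < r" "\<And>p q :: 'a. p \<in> K \<Longrightarrow> norm q < r \<Longrightarrow> p + q \<in> S"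
  proof -
    obtain r where "0 < r" and r: "(\<Union>p\<in>K. ball p r) \<subseteq> S"
      using compact_subset_open_imp_ball_epsilon_subset[OF K(1) \<open>open S\<close> K(2)] by blast
    show ?thesis
    proof (rule that[OF \<open>0 < r\<close>])
      fix p q :: 'a assume "p \<in> K" "norm q < r"
      then have "p + q \<in> ball p r" by (simp add: dist_norm)
      with \<open>p \<in> K\<close> r show "p + q \<in> S" by blast
    qed
  qed
  \<comment> \<open>The factor makes \<open>norm (h k *\<^sub>R e) < r\<close> for all \<open>k\<close>, also when \<open>e = 0\<close>.\<close>
  define h where "h k = r / (norm e + 1) / real (k + 2)" for k
  have h_pos: "0 < h k" for k using r(1) by (simp add: h_def add_nonneg_pos)
  have h_small: "norm (s *\<^sub>R (h k *\<^sub>R e)) < r" if "s \<in> {0..1}" for s k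
  proof -
    have "norm (s *\<^sub>R (h k *\<^sub>R e)) = s * (h k * norm e)"
      using that h_pos[of k] by simp
    also have "\<dots> \<le> 1 * (h k * norm e)" using that h_pos[of k] by (intro mult_right_mono) auto
    also have "\<dots> \<le> h k * (norm e + 1)" using h_pos[of k] by (simp add: algebra_simps)
    also have "\<dots> = r / real (k + 2)"
      unfolding h_def using norm_ge_zero[of e] by (simp add: field_simps add_nonneg_eq_0_iff)
    also have "\<dots> < r" using r(1) by (simp add: field_simps add_pos_nonneg)
    finally show ?thesis .
  qed
  have h_lim: "h \<longlonglongrightarrow> 0"
    unfolding h_def by (intro tendsto_divide_0[OF tendsto_const] filterlim_at_top_imp_at_infinity
        filterlim_compose[OF filterlim_real_sequentially filterlim_add_const_nat_at_top])
  then have he_lim: "(\<lambda>k. h k *\<^sub>R e) \<longlonglongrightarrow> 0"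
    by (auto intro!: tendsto_eq_intros)
  have GU_bd: "\<bar>G (U p)\<bar> \<le> LG" for p by (rule LG[OF U(2)])
  have GU_meas[measurable]: "(\<lambda>p. G (U p)) \<in> borel_measurable borel" by measurable
  define A where "A k p = (LINT s:{0..1}|lborel. V (p + s *\<^sub>R (h k *\<^sub>R e)))" for k p
  have A_meas[measurable]: "A k \<in> borel_measurable borel" for k
    unfolding A_def[abs_def] by (rule segment_integral_measurable[OF V(1)])
  have A_bd: "\<bar>A k p\<bar> \<le> D" for k p
    unfolding A_def by (rule segment_integral_bound[OF V])
  \<comment> \<open>The left side is \<open>\<integral> G(U)\<close> against the difference quotient of \<open>\<phi>\<close>, written with averages.\<close>
  have X: "(LINT p|lborel. D\<phi> p * (LINT s:{0..1}|lborel. G (U (p + s *\<^sub>R (h k *\<^sub>R e))))) =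
      - (LINT p|lborel. \<phi> p * ((G (U (p + h k *\<^sub>R e)) - G (U p)) / h k))" (is "?X k = _") for k
  proof -
    have seg: "h k * (LINT s:{0..1}|lborel. D\<phi> (p - s *\<^sub>R (h k *\<^sub>R e))) = \<phi> p - \<phi> (p - h k *\<^sub>R e)" for p
    proof -
      have lin: "linear (frechet_derivative \<phi> (at q))" for q
        using test_functionsD(3)[OF \<phi>] has_derivative_linear by blast
      have "(LINT s:{0..1}|lborel. - h k * D\<phi> (p + s *\<^sub>R - (h k *\<^sub>R e))) =
          segment_average (- (h k *\<^sub>R e)) (\<lambda>p. - h k * D\<phi> p) p"
        by (rule segment_average_lborel[symmetric]) (intro continuous_intros D\<phi>_cont)
      also have "\<dots> = segment_average (- (h k *\<^sub>R e)) (\<lambda>p. frechet_derivative \<phi> (at p) (- (h k *\<^sub>R e))) p"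
        by (simp add: D\<phi>_def linear_neg[OF lin] linear_scale[OF lin])
      also have "\<dots> = \<phi> (p + - (h k *\<^sub>R e)) - \<phi> p"
        by (rule segment_average_increment[OF test_functionsD(1)[OF \<phi>, of "Suc 0"]])
      finally have "- h k * (LINT s:{0..1}|lborel. D\<phi> (p + s *\<^sub>R - (h k *\<^sub>R e))) = \<phi> (p + - (h k *\<^sub>R e)) - \<phi> p"
        by (simp only: set_integral_mult_right)
      then show ?thesis by simp
    qed
    have i1: "integrable lborel (\<lambda>p. G (U p) * \<phi> (p + b))" for b
      using integrable_mult_bounded[OF lborel_integrable_shift[OF \<phi>_int, of b] GU_meas GU_bd]
      by (simp add: mult.commute)
    have i2: "integrable lborel (\<lambda>p. G (U (p + h k *\<^sub>R e)) * \<phi> p)"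
      using lborel_integrable_shift[OF i1[of "- (h k *\<^sub>R e)"], of "h k *\<^sub>R e"] by simp
    have cancel: "h k * (a * (b / h k)) = a * b" for a b using h_pos[of k] by simp
    have "h k * ?X k = h k * (LINT p|lborel. G (U p) * (LINT s:{0..1}|lborel. D\<phi> (p - s *\<^sub>R (h k *\<^sub>R e))))"
      by (simp only: integral_segment_adjoint[OF D\<phi>_int GU_meas GU_bd])
    also have "\<dots> = (LINT p|lborel. G (U p) * (h k * (LINT s:{0..1}|lborel. D\<phi> (p - s *\<^sub>R (h k *\<^sub>R e)))))"
      by (simp only: integral_mult_right_zero[symmetric] mult.left_commute)
    also have "\<dots> = (LINT p|lborel. G (U p) * \<phi> p - G (U p) * \<phi> (p - h k *\<^sub>R e))"
      by (simp only: seg right_diff_distrib)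
    also have "\<dots> = (LINT p|lborel. G (U p) * \<phi> p) - (LINT p|lborel. G (U p) * \<phi> (p - h k *\<^sub>R e))"
      using i1[of 0] i1[of "- (h k *\<^sub>R e)"] by simp
    also have "(LINT p|lborel. G (U p) * \<phi> (p - h k *\<^sub>R e)) = (LINT p|lborel. G (U (p + h k *\<^sub>R e)) * \<phi> p)"
      using lborel_integral_shift[of "\<lambda>p. G (U p) * \<phi> (p - h k *\<^sub>R e)" "h k *\<^sub>R e"] by simp
    also have "(LINT p|lborel. G (U p) * \<phi> p) - \<dots> =
        - (LINT p|lborel. G (U (p + h k *\<^sub>R e)) * \<phi> p - G (U p) * \<phi> p)"
      using i1[of 0] i2 by simp
    also have "\<dots> = - (LINT p|lborel. h k * (\<phi> p * ((G (U (p + h k *\<^sub>R e)) - G (U p)) / h k)))"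
      by (intro arg_cong[where f=uminus] Bochner_Integration.integral_cong refl)
         (simp only: cancel, simp add: algebra_simps)
    finally have "h k * ?X k = h k * - (LINT p|lborel. \<phi> p * ((G (U (p + h k *\<^sub>R e)) - G (U p)) / h k))"
      by simp
    then show ?thesis using h_pos[of k] by (subst (asm) mult_left_cancel) auto
  qed
  have X_lim: "?X \<longlonglongrightarrow> (LINT p|lborel. D\<phi> p * G (U p))"
    by (rule pairing_segment_average_tendsto[OF D\<phi>_meas B' K(1) D\<phi>0 GU_meas GU_bd he_lim])
  define H where "H p = \<phi> p * G' (U p)" for p
  have H_meas[measurable]: "H \<in> borel_measurable borel" unfolding H_def by measurable
  have H_bd: "\<bar>H p\<bar> \<le> B * L" for p
    unfolding H_def abs_mult using B L[OF U(2)[of p]] by (intro mult_mono) auto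
  have H0: "H p = 0" if "p \<notin> K" for p using K(3)[OF that] by (simp add: H_def)
  have Y_lim: "(\<lambda>k. (LINT p|lborel. H p * A k p)) \<longlonglongrightarrow> (LINT p|lborel. H p * V p)"
    unfolding A_def by (rule pairing_segment_average_tendsto[OF H_meas H_bd K(1) H0 V he_lim])
  \<comment> \<open>The error made by replacing \<open>G'(z)\<close> with \<open>G'(U)\<close>.\<close>
  define E where "E k p = H p * A k p - \<phi> p * ((G (U (p + h k *\<^sub>R e)) - G (U p)) / h k)" for k p
  have incr: "AE p in lborel. \<forall>k. \<phi> p * (U (p + h k *\<^sub>R e) - U p) = \<phi> p * (h k * A k p)"
    unfolding AE_all_countable
  proof
    fix k
    show "AE p in lborel. \<phi> p * (U (p + h k *\<^sub>R e) - U p) = \<phi> p * (h k * A k p)"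
      unfolding A_def
    proof (rule distributional_increment[OF DD U V \<phi> K(1,3)])
      show "p + s *\<^sub>R (h k *\<^sub>R e) \<in> S" if "p \<in> K" "s \<in> {0..1}" for p s
        by (rule r(2)[OF that(1) h_small[OF that(2)]])
    qed
  qed
  have E_repr: "\<exists>z. \<forall>k. \<bar>z k\<bar> \<le> C \<and> \<bar>z k - U p\<bar> \<le> h k * D \<and> E k p = \<phi> p * A k p * (G' (U p) - G' (z k))"
    if inc: "\<forall>k. \<phi> p * (U (p + h k *\<^sub>R e) - U p) = \<phi> p * (h k * A k p)" for p
  proof (intro choice allI)
    fix k
    show "\<exists>z. \<bar>z\<bar> \<le> C \<and> \<bar>z - U p\<bar> \<le> h k * D \<and> E k p = \<phi> p * A k p * (G' (U p) - G' z)"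
    proof (cases "\<phi> p = 0")
      case True
      then show ?thesis using U(2)[of p] h_pos[of k] D
        by (intro exI[of _ "U p"]) (simp add: E_def H_def)
    next
      case False
      define x y where "x = U p" and "y = U (p + h k *\<^sub>R e)"
      have yx: "y - x = h k * A k p" using inc False by (simp add: x_def y_def)
      have "\<exists>z. \<bar>z - x\<bar> \<le> \<bar>y - x\<bar> \<and> \<bar>z\<bar> \<le> max \<bar>x\<bar> \<bar>y\<bar> \<and> G y - G x = (y - x) * G' z"
      proof -
        consider "x < y" | "y < x" | "x = y" by linarith
        then show ?thesis
        proof cases
          case 1
          obtain z where "x < z" "z < y" "G y - G x = (y - x) * G' z"
            using MVT2[OF 1, of G G'] G by blast
          then show ?thesis by (intro exI[of _ z]) auto
        next
          case 2
          obtain z where "y < z" "z < x" "G x - G y = (x - y) * G' z"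
            using MVT2[OF 2, of G G'] G by blast
          then show ?thesis by (intro exI[of _ z]) (auto simp: algebra_simps)
        qed auto
      qed
      then obtain z where z: "\<bar>z - x\<bar> \<le> \<bar>y - x\<bar>" "\<bar>z\<bar> \<le> max \<bar>x\<bar> \<bar>y\<bar>" "G y - G x = (y - x) * G' z"
        by blast
      have "\<bar>z\<bar> \<le> C" using z(2) U(2)[of p] U(2)[of "p + h k *\<^sub>R e"] by (simp add: x_def y_def)
      moreover have "\<bar>z - x\<bar> \<le> h k * D"
        using z(1) yx A_bd[of k p] h_pos[of k] by (simp add: abs_mult) (meson mult_left_mono less_imp_le order_trans)
      moreover have "E k p = \<phi> p * A k p * (G' x - G' z)"
        using z(3) yx h_pos[of k] by (simp add: E_def H_def x_def[symmetric] y_def[symmetric] algebra_simps)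
      ultimately show ?thesis unfolding x_def by blast
    qed
  qed
  have "(\<lambda>k. (LINT p|lborel. E k p)) \<longlonglongrightarrow> integral\<^sup>L lborel (\<lambda>p::'a. 0)"
  proof (rule integral_dominated_convergence)
    show "integrable lborel (\<lambda>p. indicator K p * (B * D * (2 * L)))"
      using K(1) emeasure_compact_finite[OF K(1)]
      by (intro integrable_mult_left integrable_real_indicator) (auto simp: compact_imp_closed borel_closed)
    show "E k \<in> borel_measurable lborel" for k unfolding E_def by measurable
    show "AE p in lborel. (\<lambda>k. E k p) \<longlonglongrightarrow> 0"
      using incr
    proof (rule AE_mp[OF _ AE_I2[OF impI]])
      fix p assume "\<forall>k. \<phi> p * (U (p + h k *\<^sub>R e) - U p) = \<phi> p * (h k * A k p)"
      from E_repr[OF this] obtain z where z: "\<And>k. \<bar>z k - U p\<bar> \<le> h k * D"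
        "\<And>k. E k p = \<phi> p * A k p * (G' (U p) - G' (z k))" by metis
      have "(\<lambda>k. z k - U p) \<longlonglongrightarrow> 0"
        by (rule Lim_null_comparison[where g="\<lambda>k. h k * D"])
           (auto intro!: always_eventually tendsto_eq_intros z h_lim)
      then have "z \<longlonglongrightarrow> U p" by (simp add: LIM_zero_iff)
      then have "(\<lambda>k. G' (z k)) \<longlonglongrightarrow> G' (U p)"
        using G' isCont_tendsto_compose[of "U p" G'] by (simp add: continuous_on_eq_continuous_at)
      then have l: "(\<lambda>k. B * D * \<bar>G' (U p) - G' (z k)\<bar>) \<longlonglongrightarrow> 0"
        by (auto intro!: tendsto_eq_intros)
      show "(\<lambda>k. E k p) \<longlonglongrightarrow> 0"
      proof (rule Lim_null_comparison[OF always_eventually l], rule allI)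
        fix k
        have "\<bar>\<phi> p\<bar> * \<bar>A k p\<bar> \<le> B * D" using B A_bd[of k p] by (intro mult_mono) auto
        then show "norm (E k p) \<le> B * D * \<bar>G' (U p) - G' (z k)\<bar>"
          by (simp add: z(2) abs_mult mult_right_mono)
      qed
    qed
    show "AE p in lborel. norm (E k p) \<le> indicator K p * (B * D * (2 * L))" for k
      using incr
    proof (rule AE_mp[OF _ AE_I2[OF impI]])
      fix p assume "\<forall>k. \<phi> p * (U (p + h k *\<^sub>R e) - U p) = \<phi> p * (h k * A k p)"
      from E_repr[OF this] obtain z where z: "\<And>k. \<bar>z k\<bar> \<le> C"
        "\<And>k. E k p = \<phi> p * A k p * (G' (U p) - G' (z k))" by metis
      have "\<bar>\<phi> p * A k p\<bar> \<le> B * D" unfolding abs_mult using B A_bd[of k p] by (intro mult_mono) auto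
      moreover have "\<bar>G' (U p) - G' (z k)\<bar> \<le> 2 * L" using L[OF U(2)[of p]] L[OF z(1)[of k]] by linarith
      ultimately have "\<bar>E k p\<bar> \<le> B * D * (2 * L)"
        unfolding z(2) abs_mult[of "\<phi> p * A k p"] using B D by (intro mult_mono) auto
      then show "norm (E k p) \<le> indicator K p * (B * D * (2 * L))"
        using K(3)[of p] H0[of p] by (cases "p \<in> K") (auto simp: E_def)
    qed
  qed auto
  then have E_lim: "(\<lambda>k. (LINT p|lborel. E k p)) \<longlonglongrightarrow> 0" by simp
  have "(LINT p|lborel. E k p) = (LINT p|lborel. H p * A k p) + ?X k" for k
  proof -
    have i1: "integrable lborel (\<lambda>p. H p * A k p)"
    proof (rule integrable_bounded_compact_support[where K=K and B="B * L * D"])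
      show "\<bar>H p * A k p\<bar> \<le> B * L * D" for p
        unfolding abs_mult using H_bd[of p] A_bd[of k p] B L0 by (intro mult_mono) auto
    qed (use K(1) H0 in auto)
    have i2: "integrable lborel (\<lambda>p. \<phi> p * ((G (U (p + h k *\<^sub>R e)) - G (U p)) / h k))"
    proof (rule integrable_bounded_compact_support[where K=K and B="B * (2 * LG / h k)"])
      fix p
      have "\<bar>G (U (p + h k *\<^sub>R e)) - G (U p)\<bar> \<le> 2 * LG"
        using GU_bd[of p] GU_bd[of "p + h k *\<^sub>R e"] by linarith
      then have "\<bar>(G (U (p + h k *\<^sub>R e)) - G (U p)) / h k\<bar> \<le> 2 * LG / h k"
        using h_pos[of k] by (simp add: divide_right_mono)
      then show "\<bar>\<phi> p * ((G (U (p + h k *\<^sub>R e)) - G (U p)) / h k)\<bar> \<le> B * (2 * LG / h k)"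
        unfolding abs_mult using B by (intro mult_mono) auto
    qed (use K(1,3) in auto)
    show ?thesis unfolding X E_def using i1 i2 by simp
  qed
  then have "(\<lambda>k. (LINT p|lborel. H p * A k p) + ?X k) \<longlonglongrightarrow> 0" using E_lim by simp
  with tendsto_add[OF Y_lim X_lim]
  have "(LINT p|lborel. H p * V p) + (LINT p|lborel. D\<phi> p * G (U p)) = 0"
    using LIMSEQ_unique by blast
  then show "(LINT p|lborel. G (U p) * frechet_derivative \<phi> (at p) e) = - (LINT p|lborel. G' (U p) * V p * \<phi> p)"
    by (simp add: D\<phi>_def H_def mult_ac add_eq_0_iff)
qed

lemma distributional_derivative_limit:
  fixes U V :: "nat \<Rightarrow> 'a::euclidean_space \<Rightarrow> real"
  assumes DD: "\<And>n. distributional_derivative S (U n) e (V n)"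
    and U: "\<And>n. U n \<in> borel_measurable borel" "\<And>n p. \<bar>U n p\<bar> \<le> C" "\<And>p. (\<lambda>n. U n p) \<longlonglongrightarrow> U' p"
    and V: "\<And>n. V n \<in> borel_measurable borel" "\<And>n p. \<bar>V n p\<bar> \<le> D" "\<And>p. (\<lambda>n. V n p) \<longlonglongrightarrow> V' p"
  shows "distributional_derivative S U' e V'"
  unfolding distributional_derivative_def
proof
  fix \<phi> :: "'a \<Rightarrow> real" assume \<phi>: "\<phi> \<in> test_functions S"
  note [measurable] = U(1) V(1)
  obtain K where K: "compact K" "K \<subseteq> S" "\<And>p. p \<notin> K \<Longrightarrow> \<phi> p = 0"
    "\<And>p e. p \<notin> K \<Longrightarrow> frechet_derivative \<phi> (at p) e = 0"
    using test_functions_support[OF \<phi>] by blast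
  have lim: "(\<lambda>n. (LINT p|lborel. F n p * \<psi> p)) \<longlonglongrightarrow> (LINT p|lborel. F' p * \<psi> p)"
    if [measurable]: "\<And>n. F n \<in> borel_measurable borel" and F: "\<And>n p. \<bar>F n p\<bar> \<le> c" "\<And>p. (\<lambda>n. F n p) \<longlonglongrightarrow> F' p"
      and \<psi>: "continuous_on UNIV \<psi>" "\<And>p. p \<notin> K \<Longrightarrow> \<psi> p = 0"
    for F :: "nat \<Rightarrow> 'a \<Rightarrow> real" and F' \<psi> c
  proof (rule integral_dominated_convergence)
    have [measurable]: "\<psi> \<in> borel_measurable borel" by (rule borel_measurable_continuous_onI[OF \<psi>(1)])
    have [measurable]: "F' \<in> borel_measurable borel"
      by (rule borel_measurable_LIMSEQ_real[where u=F]) (use F(2) in auto)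
    obtain B where "\<And>p. \<bar>\<psi> p\<bar> \<le> B"
      using continuous_compact_support_bounded[OF \<psi>(1) K(1) \<psi>(2)] by blast
    then have "integrable lborel \<psi>"
      by (intro integrable_bounded_compact_support[where K=K]) (use K(1) \<psi>(2) in auto)
    then show "integrable lborel (\<lambda>p. c * \<bar>\<psi> p\<bar>)" by (intro integrable_mult_right integrable_abs)
    show "AE p in lborel. (\<lambda>n. F n p * \<psi> p) \<longlonglongrightarrow> F' p * \<psi> p"
      by (intro AE_I2 tendsto_intros F)
    show "AE p in lborel. norm (F n p * \<psi> p) \<le> c * \<bar>\<psi> p\<bar>" for n
      using F(1) by (intro AE_I2) (simp add: abs_mult mult_right_mono)
    show "(\<lambda>p. F' p * \<psi> p) \<in> borel_measurable lborel" "(\<lambda>p. F n p * \<psi> p) \<in> borel_measurable lborel" for n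
      by measurable
  qed
  have "(\<lambda>n. (LINT p|lborel. U n p * frechet_derivative \<phi> (at p) e))
      \<longlonglongrightarrow> (LINT p|lborel. U' p * frechet_derivative \<phi> (at p) e)"
    by (rule lim[OF U(1,2,3) Ck_continuous_frechet[OF test_functionsD(1)[OF \<phi>]] K(4)])
  moreover have "(\<lambda>n. - (LINT p|lborel. V n p * \<phi> p)) \<longlonglongrightarrow> - (LINT p|lborel. V' p * \<phi> p)"
    by (intro tendsto_minus lim[OF V(1,2,3) test_functionsD(2)[OF \<phi>] K(3)])
  moreover have "(LINT p|lborel. U n p * frechet_derivative \<phi> (at p) e) = - (LINT p|lborel. V n p * \<phi> p)" for n
    using DD[of n] \<phi> by (simp add: distributional_derivative_def)
  ultimately show "(LINT p|lborel. U' p * frechet_derivative \<phi> (at p) e) = - (LINT p|lborel. V' p * \<phi> p)"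
    using LIMSEQ_unique by simp blast
qed

text \<open>The chain rule for the Kruzhkov entropy flux; \<open>f\<close> the identity gives the entropy \<open>\<bar>U - c\<bar>\<close>. The flux is
  \<open>f(max y c) - f(min y c)\<close>. Replacing \<open>\<bar>y - c\<bar>\<close> by \<open>\<rho>(y) = sqrt ((y - c)\<^sup>2 + \<delta>)\<close> in \<open>max\<close> and \<open>min\<close> makes it
  continuously differentiable, and its derivative converges everywhere. At \<open>y = c\<close> the limit is
  \<open>f'(c) / 2 - f'(c) / 2 = 0\<close>, which agrees with \<open>sgn 0 = 0\<close>.\<close>

lemma distributional_entropy_flux:
  fixes U V :: "'a::euclidean_space \<Rightarrow> real" and f f' :: "real \<Rightarrow> real"
  assumes "open S" and DD: "distributional_derivative S U e V"
    and U: "U \<in> borel_measurable borel" "\<And>p. \<bar>U p\<bar> \<le> C"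
    and V: "V \<in> borel_measurable borel" "\<And>p. \<bar>V p\<bar> \<le> D"
    and f: "\<And>y. (f has_real_derivative f' y) (at y)" and f': "continuous_on UNIV f'"
  shows "distributional_derivative S (\<lambda>p. sgn (U p - c) * (f (U p) - f c)) e
    (\<lambda>p. sgn (U p - c) * f' (U p) * V p)"
proof -
  note [measurable] = U(1) V(1)
  have contf: "continuous_on UNIV f"
    using f by (meson DERIV_isCont continuous_at_imp_continuous_on)
  have C: "0 \<le> C" using U(2)[of 0] by linarith
  have D: "0 \<le> D" using V(2)[of 0] by linarith
  define R where "R = C + 2 * \<bar>c\<bar> + 1"
  obtain B where B: "\<And>y. \<bar>y\<bar> \<le> R \<Longrightarrow> \<bar>f y\<bar> \<le> B"
    by (rule continuous_bounded_on_interval[OF contf]) blast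
  obtain B' where B': "\<And>y. \<bar>y\<bar> \<le> R \<Longrightarrow> \<bar>f' y\<bar> \<le> B'"
    by (rule continuous_bounded_on_interval[OF f']) blast
  define \<delta> where "\<delta> n = inverse (real (Suc n))" for n
  have \<delta>: "0 < \<delta> n" "\<delta> n \<le> 1" for n by (auto simp: \<delta>_def field_simps)
  have \<delta>_lim: "\<delta> \<longlonglongrightarrow> 0" unfolding \<delta>_def by (rule LIMSEQ_inverse_real_of_nat)
  define \<rho> where "\<rho> n y = sqrt ((y - c)\<^sup>2 + \<delta> n)" for n y
  have pos: "0 < (y - c)\<^sup>2 + \<delta> n" for y n using \<delta>(1)[of n] by (simp add: add_nonneg_pos)
  have \<rho>_pos: "0 < \<rho> n y" for n y unfolding \<rho>_def using pos by simp
  have \<rho>_lower: "\<bar>y - c\<bar> \<le> \<rho> n y" for n y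
    unfolding \<rho>_def using \<delta>(1)[of n] by (intro real_le_rsqrt) auto
  have \<rho>_upper: "\<rho> n y \<le> \<bar>y - c\<bar> + 1" for n y
  proof -
    have "sqrt ((y - c)\<^sup>2 + \<delta> n) \<le> sqrt ((y - c)\<^sup>2) + sqrt (\<delta> n)"
      by (rule sqrt_add_le_add_sqrt) (use \<delta>(1)[of n] in auto)
    also have "sqrt (\<delta> n) \<le> 1" using \<delta>(2)[of n] by simp
    finally show ?thesis by (simp add: \<rho>_def)
  qed
  have \<rho>_deriv: "(\<rho> n has_real_derivative (y - c) / \<rho> n y) (at y)" for n y
    unfolding \<rho>_def using pos[of y n]
    by (auto intro!: derivative_eq_intros simp: field_simps)
  have \<rho>_cont: "continuous_on UNIV (\<rho> n)" for n
    unfolding \<rho>_def by (intro continuous_intros)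
  have \<rho>_lim: "(\<lambda>n. \<rho> n y) \<longlonglongrightarrow> \<bar>y - c\<bar>" for y
  proof -
    have "(\<lambda>n. sqrt ((y - c)\<^sup>2 + \<delta> n)) \<longlonglongrightarrow> sqrt ((y - c)\<^sup>2 + 0)"
      by (intro tendsto_intros \<delta>_lim)
    then show ?thesis by (simp add: \<rho>_def)
  qed
  define \<sigma> where "\<sigma> n y = (y - c) / \<rho> n y" for n y
  have \<sigma>_bd: "\<bar>\<sigma> n y\<bar> \<le> 1" for n y
    using \<rho>_lower[of y n] \<rho>_pos[of n y] by (simp add: \<sigma>_def)
  have \<sigma>_cont: "continuous_on UNIV (\<sigma> n)" for n
    unfolding \<sigma>_def using \<rho>_pos by (intro continuous_intros \<rho>_cont) (metis less_irrefl)
  have \<sigma>_lim: "(\<lambda>n. \<sigma> n y) \<longlonglongrightarrow> sgn (y - c)" for y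
  proof (cases "y = c")
    case False
    then have "(\<lambda>n. (y - c) / \<rho> n y) \<longlonglongrightarrow> (y - c) / \<bar>y - c\<bar>"
      by (intro tendsto_intros \<rho>_lim) auto
    moreover have "(y - c) / \<bar>y - c\<bar> = sgn (y - c)" using False by (auto simp: sgn_if abs_if divide_simps)
    ultimately show ?thesis by (simp add: \<sigma>_def)
  qed (simp add: \<sigma>_def)
  \<comment> \<open>Smooth substitutes for \<open>max y c\<close> and \<open>min y c\<close>.\<close>
  define a b where "a n y = c + (y - c + \<rho> n y) / 2" and "b n y = c + (y - c - \<rho> n y) / 2" for n y
  have ab_bd: "\<bar>a n y\<bar> \<le> R" "\<bar>b n y\<bar> \<le> R" if "\<bar>y\<bar> \<le> C" for n y
  proof -
    have mid: "\<bar>c + d / 2\<bar> \<le> R" if "\<bar>d\<bar> \<le> 2 * (C + \<bar>c\<bar>) + 1" for d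
    proof -
      have "\<bar>c + d / 2\<bar> \<le> \<bar>c\<bar> + \<bar>d\<bar> / 2" using abs_triangle_ineq[of c "d / 2"] by simp
      then show ?thesis using that unfolding R_def by argo
    qed
    have "\<bar>y - c\<bar> \<le> C + \<bar>c\<bar>" using that by linarith
    then have "\<bar>y - c + \<rho> n y\<bar> \<le> 2 * (C + \<bar>c\<bar>) + 1" "\<bar>y - c - \<rho> n y\<bar> \<le> 2 * (C + \<bar>c\<bar>) + 1"
      using \<rho>_upper[of n y] \<rho>_pos[of n y] by (smt (verit))+
    then show "\<bar>a n y\<bar> \<le> R" "\<bar>b n y\<bar> \<le> R"
      unfolding a_def b_def by (auto intro: mid)
  qed
  define G G' where "G n y = f (a n y) - f (b n y)"
    and "G' n y = f' (a n y) * ((1 + \<sigma> n y) / 2) - f' (b n y) * ((1 - \<sigma> n y) / 2)" for n y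
  have G_deriv: "(G n has_real_derivative G' n y) (at y)" for n y
  proof -
    have "(a n has_real_derivative (1 + \<sigma> n y) / 2) (at y)"
      "(b n has_real_derivative (1 - \<sigma> n y) / 2) (at y)"
      unfolding a_def b_def \<sigma>_def by (auto intro!: derivative_eq_intros \<rho>_deriv)
    then show ?thesis unfolding G_def G'_def
      by (intro DERIV_diff DERIV_chain2[OF f])
  qed
  have a_cont: "continuous_on UNIV (a n)" and b_cont: "continuous_on UNIV (b n)" for n
    unfolding a_def b_def by (intro continuous_intros \<rho>_cont; simp)+
  have G_cont: "continuous_on UNIV (G n)" for n
    using G_deriv by (meson DERIV_isCont continuous_at_imp_continuous_on)
  have G'_cont: "continuous_on UNIV (G' n)" for n
    unfolding G'_def
    by (intro continuous_intros \<sigma>_cont continuous_on_compose2[OF f' a_cont] continuous_on_compose2[OF f' b_cont]) auto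
  note [measurable] = borel_measurable_continuous_onI[OF G_cont] borel_measurable_continuous_onI[OF G'_cont]
  have isCont: "isCont f y" "isCont f' y" for y
    using contf f' by (auto simp: continuous_on_eq_continuous_at)
  have a_lim: "(\<lambda>n. a n y) \<longlonglongrightarrow> c + (y - c + \<bar>y - c\<bar>) / 2"
    and b_lim: "(\<lambda>n. b n y) \<longlonglongrightarrow> c + (y - c - \<bar>y - c\<bar>) / 2" for y
    unfolding a_def b_def by (intro tendsto_intros \<rho>_lim; simp)+
  have G_lim: "(\<lambda>n. G n y) \<longlonglongrightarrow> sgn (y - c) * (f y - f c)" for y
  proof -
    have "(\<lambda>n. G n y) \<longlonglongrightarrow> f (c + (y - c + \<bar>y - c\<bar>) / 2) - f (c + (y - c - \<bar>y - c\<bar>) / 2)"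
      unfolding G_def by (intro tendsto_intros isCont_tendsto_compose[OF isCont(1)] a_lim b_lim)
    moreover have "f (c + (y - c + \<bar>y - c\<bar>) / 2) - f (c + (y - c - \<bar>y - c\<bar>) / 2) = sgn (y - c) * (f y - f c)"
      by (cases y c rule: linorder_cases) (auto simp: diff_divide_distrib)
    ultimately show ?thesis by simp
  qed
  have G'_lim: "(\<lambda>n. G' n y) \<longlonglongrightarrow> sgn (y - c) * f' y" for y
  proof -
    have "(\<lambda>n. G' n y) \<longlonglongrightarrow> f' (c + (y - c + \<bar>y - c\<bar>) / 2) * ((1 + sgn (y - c)) / 2)
        - f' (c + (y - c - \<bar>y - c\<bar>) / 2) * ((1 - sgn (y - c)) / 2)"
      unfolding G'_def
      by (intro tendsto_intros isCont_tendsto_compose[OF isCont(2)] a_lim b_lim \<sigma>_lim) auto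
    moreover have "f' (c + (y - c + \<bar>y - c\<bar>) / 2) * ((1 + sgn (y - c)) / 2)
        - f' (c + (y - c - \<bar>y - c\<bar>) / 2) * ((1 - sgn (y - c)) / 2) = sgn (y - c) * f' y"
      by (cases y c rule: linorder_cases) (auto simp: diff_divide_distrib)
    ultimately show ?thesis by simp
  qed
  show ?thesis
  proof (rule distributional_derivative_limit)
    show "distributional_derivative S (\<lambda>p. G n (U p)) e (\<lambda>p. G' n (U p) * V p)" for n
      by (rule distributional_chain_rule[OF \<open>open S\<close> DD U V G_deriv G'_cont])
    show "(\<lambda>p. G n (U p)) \<in> borel_measurable borel" "(\<lambda>p. G' n (U p) * V p) \<in> borel_measurable borel" for n
      by measurable
    show "\<bar>G n (U p)\<bar> \<le> 2 * B" for n p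
      using B[OF ab_bd(1)[OF U(2)[of p], of n]] B[OF ab_bd(2)[OF U(2)[of p], of n]]
      unfolding G_def by linarith
    show "\<bar>G' n (U p) * V p\<bar> \<le> 2 * B' * D" for n p
    proof -
      have *: "\<bar>x * s\<bar> \<le> B'" if "\<bar>x\<bar> \<le> B'" "\<bar>s\<bar> \<le> 1" for x s :: real
        using mult_mono[OF that] that by (simp add: abs_mult)
      have "\<bar>f' (a n (U p)) * ((1 + \<sigma> n (U p)) / 2)\<bar> \<le> B'"
        "\<bar>f' (b n (U p)) * ((1 - \<sigma> n (U p)) / 2)\<bar> \<le> B'"
        using \<sigma>_bd[of n "U p"] by (intro * B' ab_bd U; auto simp: abs_le_iff)+
      then have "\<bar>G' n (U p)\<bar> \<le> 2 * B'" unfolding G'_def by linarith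
      then show ?thesis unfolding abs_mult using V(2)[of p] by (intro mult_mono) auto
    qed
    show "(\<lambda>n. G n (U p)) \<longlonglongrightarrow> sgn (U p - c) * (f (U p) - f c)" for p by (rule G_lim)
    show "(\<lambda>n. G' n (U p) * V p) \<longlonglongrightarrow> sgn (U p - c) * f' (U p) * V p" for p
      by (intro tendsto_intros G'_lim)
  qed
qed

section \<open>Primitives along a direction\<close>

lemma integral_shifted_away_tendsto:
  fixes W \<psi> :: "'a::euclidean_space \<Rightarrow> real"
  assumes W: "integrable lborel W" and \<psi>: "continuous_on UNIV \<psi>"
    and K: "compact K" "\<And>p. p \<notin> K \<Longrightarrow> \<psi> p = 0" and e: "e \<noteq> 0"
  shows "(\<lambda>n. (LINT p|lborel. W p * \<psi> (p + real n *\<^sub>R e))) \<longlonglongrightarrow> 0"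
proof -
  have [measurable]: "W \<in> borel_measurable borel" using borel_measurable_integrable[OF W] by simp
  have [measurable]: "\<psi> \<in> borel_measurable borel" by (rule borel_measurable_continuous_onI[OF \<psi>])
  obtain B where B: "\<And>p. \<bar>\<psi> p\<bar> \<le> B"
    using continuous_compact_support_bounded[OF \<psi> K] by blast
  obtain R where R: "\<And>p. p \<in> K \<Longrightarrow> norm p \<le> R"
    using compact_imp_bounded[OF K(1)] unfolding bounded_iff by blast
  have "(\<lambda>n. (LINT p|lborel. W p * \<psi> (p + real n *\<^sub>R e))) \<longlonglongrightarrow> integral\<^sup>L lborel (\<lambda>p::'a. 0)"
  proof (rule integral_dominated_convergence)
    show "integrable lborel (\<lambda>p. B * \<bar>W p\<bar>)" by (intro integrable_mult_right integrable_abs W)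
    show "AE p in lborel. norm (W p * \<psi> (p + real n *\<^sub>R e)) \<le> B * \<bar>W p\<bar>" for n
      using B by (intro AE_I2) (simp add: abs_mult mult.commute[of B] mult_left_mono)
    show "AE p in lborel. (\<lambda>n. W p * \<psi> (p + real n *\<^sub>R e)) \<longlonglongrightarrow> 0"
    proof (rule AE_I2)
      fix p :: 'a
      obtain N :: nat where N: "(R + norm p) / norm e < real N" using reals_Archimedean2 by blast
      have "\<psi> (p + real n *\<^sub>R e) = 0" if "N \<le> n" for n
      proof (rule K(2))
        have "R + norm p < real N * norm e" using N e by (simp add: field_simps)
        also have "\<dots> \<le> real n * norm e" using that by (intro mult_right_mono) auto
        also have "\<dots> = norm ((p + real n *\<^sub>R e) - p)" by simp
        also have "\<dots> \<le> norm (p + real n *\<^sub>R e) + norm p" by (rule norm_triangle_ineq4)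
        finally show "p + real n *\<^sub>R e \<notin> K" using R[of "p + real n *\<^sub>R e"] by auto
      qed
      then have "\<forall>\<^sub>F n in sequentially. W p * \<psi> (p + real n *\<^sub>R e) = 0"
        unfolding eventually_sequentially by auto
      then show "(\<lambda>n. W p * \<psi> (p + real n *\<^sub>R e)) \<longlonglongrightarrow> 0" by (rule tendsto_eventually)
    qed
  qed auto
  then show ?thesis by simp
qed

text \<open>\<open>U\<close> is the integral of \<open>W\<close> along the ray from infinity in direction \<open>- e\<close>, expressed through integrals over
  the unit interval so that \<open>integral_segment_adjoint\<close> applies in any dimension. Integer multiples of \<open>e\<close> suffice
  because only the limit along the ray is taken.\<close>

definition is_primitive :: "'a::euclidean_space \<Rightarrow> ('a \<Rightarrow> real) \<Rightarrow> ('a \<Rightarrow> real) \<Rightarrow> bool" where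
  "is_primitive e W U \<longleftrightarrow>
     (\<forall>p n. U p - U (p - real n *\<^sub>R e) = real n * (LINT s:{0..1}|lborel. W (p - s *\<^sub>R (real n *\<^sub>R e)))) \<and>
     (\<forall>p. (\<lambda>n. U (p - real n *\<^sub>R e)) \<longlonglongrightarrow> 0)"

lemma mult_integral_pairing:
  fixes F A :: "'a \<Rightarrow> real"
  shows "c * (LINT p|M. F p * A p) = (LINT p|M. F p * (c * A p))"
  by (simp only: integral_mult_right_zero[symmetric] mult.left_commute)

text \<open>For large \<open>n\<close>, \<open>n\<close> times the average over the segment \<open>n e\<close> is an approximate primitive of \<open>\<psi>\<close>. Pairing \<open>U\<close>
  with \<open>\<psi>\<close> thus amounts to pairing \<open>W\<close> with that primitive, which is compactly supported for each \<open>n\<close>.\<close>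

lemma primitive_pairing_tendsto:
  fixes U W \<psi> :: "'a::euclidean_space \<Rightarrow> real"
  assumes prim: "is_primitive e W U" and W: "integrable lborel W"
    and U: "U \<in> borel_measurable borel" "\<And>p. \<bar>U p\<bar> \<le> C"
    and \<psi>: "continuous_on UNIV \<psi>" and K: "compact K" "\<And>p. p \<notin> K \<Longrightarrow> \<psi> p = 0"
  shows "(\<lambda>n. real n * (LINT p|lborel. W p * segment_average (real n *\<^sub>R e) \<psi> p))
    \<longlonglongrightarrow> (LINT p|lborel. U p * \<psi> p)"
proof -
  note [measurable] = U(1)
  have \<psi>_meas[measurable]: "\<psi> \<in> borel_measurable borel" by (rule borel_measurable_continuous_onI[OF \<psi>])
  obtain B where B: "\<And>p. \<bar>\<psi> p\<bar> \<le> B"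
    using continuous_compact_support_bounded[OF \<psi> K] by blast
  have \<psi>_int: "integrable lborel \<psi>"
    by (rule integrable_bounded_compact_support[OF \<psi>_meas B K])
  have eq: "real n * (LINT p|lborel. W p * segment_average (real n *\<^sub>R e) \<psi> p) =
      (LINT p|lborel. \<psi> p * (U p - U (p - real n *\<^sub>R e)))" for n
  proof -
    have "real n * (LINT p|lborel. W p * segment_average (real n *\<^sub>R e) \<psi> p) =
        real n * (LINT p|lborel. \<psi> p * (LINT s:{0..1}|lborel. W (p - s *\<^sub>R (real n *\<^sub>R e))))"
      unfolding segment_average_lborel[OF \<psi>] by (simp only: integral_segment_adjoint[OF W \<psi>_meas B])
    also have "\<dots> = (LINT p|lborel. \<psi> p * (real n * (LINT s:{0..1}|lborel. W (p - s *\<^sub>R (real n *\<^sub>R e)))))"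
      by (rule mult_integral_pairing)
    finally show ?thesis using prim unfolding is_primitive_def by simp
  qed
  have "(\<lambda>n. (LINT p|lborel. \<psi> p * (U p - U (p - real n *\<^sub>R e)))) \<longlonglongrightarrow> (LINT p|lborel. U p * \<psi> p)"
  proof (rule integral_dominated_convergence)
    show "integrable lborel (\<lambda>p. 2 * C * \<bar>\<psi> p\<bar>)" by (intro integrable_mult_right integrable_abs \<psi>_int)
    show "AE p in lborel. (\<lambda>n. \<psi> p * (U p - U (p - real n *\<^sub>R e))) \<longlonglongrightarrow> U p * \<psi> p"
    proof (rule AE_I2)
      fix p
      have "(\<lambda>n. \<psi> p * (U p - U (p - real n *\<^sub>R e))) \<longlonglongrightarrow> \<psi> p * (U p - 0)"
        using prim unfolding is_primitive_def by (intro tendsto_intros) blast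
      then show "(\<lambda>n. \<psi> p * (U p - U (p - real n *\<^sub>R e))) \<longlonglongrightarrow> U p * \<psi> p"
        by (simp add: mult.commute)
    qed
    show "AE p in lborel. norm (\<psi> p * (U p - U (p - real n *\<^sub>R e))) \<le> 2 * C * \<bar>\<psi> p\<bar>" for n
    proof (rule AE_I2)
      fix p
      have "\<bar>U p - U (p - real n *\<^sub>R e)\<bar> \<le> 2 * C"
        using U(2)[of p] U(2)[of "p - real n *\<^sub>R e"] by linarith
      then show "norm (\<psi> p * (U p - U (p - real n *\<^sub>R e))) \<le> 2 * C * \<bar>\<psi> p\<bar>"
        by (simp add: abs_mult mult.commute[of "2 * C"] mult_left_mono)
    qed
  qed measurable
  then show ?thesis by (simp only: eq)
qed

lemma segment_average_increment_scaled:
  assumes "\<phi> \<in> test_functions S"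
  shows "c * segment_average (c *\<^sub>R e) (\<lambda>p. frechet_derivative \<phi> (at p) e) p = \<phi> (p + c *\<^sub>R e) - \<phi> p"
proof -
  have lin: "linear (frechet_derivative \<phi> (at q))" for q
    using test_functionsD(3)[OF assms] has_derivative_linear by blast
  have "segment_average (c *\<^sub>R e) (\<lambda>p. frechet_derivative \<phi> (at p) (c *\<^sub>R e)) p = \<phi> (p + c *\<^sub>R e) - \<phi> p"
    by (rule segment_average_increment[OF test_functionsD(1)[OF assms, of "Suc 0"]])
  then show ?thesis by (simp add: segment_average_def linear_scale[OF lin])
qed

lemma test_function_pairing_integrable:
  fixes W :: "'a::euclidean_space \<Rightarrow> real"
  assumes W: "integrable lborel W" and \<phi>: "\<phi> \<in> test_functions S"
  shows "integrable lborel (\<lambda>p. W p * \<phi> (p + b))"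
proof -
  note [measurable] = test_functions_measurable(1)[OF \<phi>]
  obtain K where K: "compact K" "K \<subseteq> S" "\<And>p. p \<notin> K \<Longrightarrow> \<phi> p = 0"
      "\<And>p a. p \<notin> K \<Longrightarrow> frechet_derivative \<phi> (at p) a = 0"
    using test_functions_support[OF \<phi>] by blast
  obtain B where B: "\<And>p. \<bar>\<phi> p\<bar> \<le> B"
    using continuous_compact_support_bounded[OF test_functionsD(2)[OF \<phi>] K(1,3)] by blast
  show ?thesis
    by (rule integrable_mult_bounded[OF W _ B]) measurable
qed

lemma pairing_increment_tendsto:
  assumes W: "integrable lborel W" and \<phi>: "\<phi> \<in> test_functions S" and e: "e \<noteq> 0"
  shows "(\<lambda>n. (LINT p|lborel. W p * (\<phi> (p + real n *\<^sub>R e) - \<phi> p))) \<longlonglongrightarrow> - (LINT p|lborel. W p * \<phi> p)"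
proof -
  obtain K where K: "compact K" "K \<subseteq> S" "\<And>p. p \<notin> K \<Longrightarrow> \<phi> p = 0"
      "\<And>p a. p \<notin> K \<Longrightarrow> frechet_derivative \<phi> (at p) a = 0"
    using test_functions_support[OF \<phi>] by blast
  have "(LINT p|lborel. W p * (\<phi> (p + b) - \<phi> p)) =
      (LINT p|lborel. W p * \<phi> (p + b)) - (LINT p|lborel. W p * \<phi> p)" for b
    using test_function_pairing_integrable[OF W \<phi>, of b] test_function_pairing_integrable[OF W \<phi>, of 0]
    by (simp add: right_diff_distrib)
  then show ?thesis
    using tendsto_diff[OF integral_shifted_away_tendsto[OF W test_functionsD(2)[OF \<phi>] K(1,3) e] tendsto_const]
    by simp
qed

lemma distributional_derivative_primitive:
  fixes U W :: "'a::euclidean_space \<Rightarrow> real"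
  assumes prim: "is_primitive e W U" and W: "integrable lborel W"
    and U: "U \<in> borel_measurable borel" "\<And>p. \<bar>U p\<bar> \<le> C" and e: "e \<noteq> 0"
  shows "distributional_derivative S U e W"
  unfolding distributional_derivative_def
proof
  fix \<phi> :: "'a \<Rightarrow> real" assume \<phi>: "\<phi> \<in> test_functions S"
  obtain K where K: "compact K" "K \<subseteq> S" "\<And>p. p \<notin> K \<Longrightarrow> \<phi> p = 0"
      "\<And>p a. p \<notin> K \<Longrightarrow> frechet_derivative \<phi> (at p) a = 0"
    using test_functions_support[OF \<phi>] by blast
  have "(\<lambda>n. real n * (LINT p|lborel. W p * segment_average (real n *\<^sub>R e) (\<lambda>p. frechet_derivative \<phi> (at p) e) p))
      \<longlonglongrightarrow> (LINT p|lborel. U p * frechet_derivative \<phi> (at p) e)"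
    by (rule primitive_pairing_tendsto[OF prim W U Ck_continuous_frechet[OF test_functionsD(1)[OF \<phi>]] K(1,4)])
  also have "(\<lambda>n. real n * (LINT p|lborel. W p * segment_average (real n *\<^sub>R e) (\<lambda>p. frechet_derivative \<phi> (at p) e) p)) =
      (\<lambda>n. (LINT p|lborel. W p * (\<phi> (p + real n *\<^sub>R e) - \<phi> p)))"
    by (simp only: mult_integral_pairing segment_average_increment_scaled[OF \<phi>])
  finally show "(LINT p|lborel. U p * frechet_derivative \<phi> (at p) e) = - (LINT p|lborel. W p * \<phi> p)"
    using pairing_increment_tendsto[OF W \<phi> e] LIMSEQ_unique by blast
qed

text \<open>If \<open>\<partial>\<^sub>a W + \<partial>\<^sub>e Q = 0\<close> then \<open>\<partial>\<^sub>a U = - Q\<close>: test the law with \<open>n\<close> times the average of \<open>\<phi>\<close> over the segment \<open>n e\<close>.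
  Its derivative along \<open>e\<close> is an increment of \<open>\<phi>\<close> whose far part escapes, and its derivative along \<open>a\<close> is the
  approximate primitive of \<open>\<partial>\<^sub>a\<phi>\<close>. The averages remain test functions on \<open>S\<close> because \<open>S\<close> is invariant
  under translation along \<open>e\<close>.\<close>

lemma distributional_derivative_primitive_of_conservation_law:
  fixes U W Q :: "'a::euclidean_space \<Rightarrow> real"
  assumes prim: "is_primitive e W U" and W: "integrable lborel W"
    and U: "U \<in> borel_measurable borel" "\<And>p. \<bar>U p\<bar> \<le> C"
    and Q: "integrable lborel Q" and e: "e \<noteq> 0"
    and S: "\<And>p s. p \<in> S \<Longrightarrow> p + s *\<^sub>R e \<in> S"
    and law: "\<And>\<phi>. \<phi> \<in> test_functions S \<Longrightarrow>
      (LINT p|lborel. W p * frechet_derivative \<phi> (at p) a + Q p * frechet_derivative \<phi> (at p) e) = 0"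
  shows "distributional_derivative S U a (\<lambda>p. - Q p)"
  unfolding distributional_derivative_def
proof
  fix \<phi> :: "'a \<Rightarrow> real" assume \<phi>: "\<phi> \<in> test_functions S"
  obtain K where K: "compact K" "K \<subseteq> S" "\<And>p. p \<notin> K \<Longrightarrow> \<phi> p = 0"
      "\<And>p a. p \<notin> K \<Longrightarrow> frechet_derivative \<phi> (at p) a = 0"
    using test_functions_support[OF \<phi>] by blast
  define D where "D b p = frechet_derivative \<phi> (at p) b" for b p
  have D_cont: "continuous_on UNIV (D b)" for b
    unfolding D_def[abs_def] by (rule Ck_continuous_frechet[OF test_functionsD(1)[OF \<phi>]])
  have "(LINT p|lborel. W p * segment_average (real n *\<^sub>R e) (D a) p) * real n =
      - (LINT p|lborel. Q p * (\<phi> (p + real n *\<^sub>R e) - \<phi> p))" for n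
  proof -
    define \<Phi> where "\<Phi> = segment_average (real n *\<^sub>R e) \<phi>"
    have "\<Phi> \<in> test_functions S"
      unfolding \<Phi>_def
    proof (rule test_functions_segment_average[OF \<phi> K(1,3)])
      show "p - s *\<^sub>R real n *\<^sub>R e \<in> S" if "p \<in> K" for p s
        using S[of p "- (s * real n)"] that K(2) by auto
    qed
    note \<Phi> = this
    have d: "frechet_derivative \<Phi> (at p) b = segment_average (real n *\<^sub>R e) (D b) p" for p b
      unfolding \<Phi>_def D_def
      by (rule frechet_derivative_segment_average[OF test_functionsD(1)[OF \<phi>, of "Suc 0"]])
    have int: "integrable lborel (\<lambda>p. F p * frechet_derivative \<Phi> (at p) b)" if F: "integrable lborel F" for F b
    proof -
      obtain K' where K': "compact K'" "K' \<subseteq> S" "\<And>p. p \<notin> K' \<Longrightarrow> \<Phi> p = 0"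
      "\<And>p b. p \<notin> K' \<Longrightarrow> frechet_derivative \<Phi> (at p) b = 0"
        using test_functions_support[OF \<Phi>] by blast
      obtain B where B: "\<And>p. \<bar>frechet_derivative \<Phi> (at p) b\<bar> \<le> B"
        using continuous_compact_support_bounded[OF Ck_continuous_frechet[OF test_functionsD(1)[OF \<Phi>]] K'(1,4)] by blast
      show ?thesis
        by (rule integrable_mult_bounded[OF F test_functions_measurable(2)[OF \<Phi>] B])
    qed
    have "(LINT p|lborel. W p * frechet_derivative \<Phi> (at p) a) +
        (LINT p|lborel. Q p * frechet_derivative \<Phi> (at p) e) = 0"
      using law[OF \<Phi>] int[OF W] int[OF Q] by simp
    then have "(LINT p|lborel. W p * frechet_derivative \<Phi> (at p) a) * real n =
        - (real n * (LINT p|lborel. Q p * frechet_derivative \<Phi> (at p) e))"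
      by (simp add: eq_neg_iff_add_eq_0[symmetric])
    also have "\<dots> = - (LINT p|lborel. Q p * (real n * frechet_derivative \<Phi> (at p) e))"
      by (simp only: mult_integral_pairing)
    also have "\<dots> = - (LINT p|lborel. Q p * (\<phi> (p + real n *\<^sub>R e) - \<phi> p))"
      unfolding d D_def by (simp only: segment_average_increment_scaled[OF \<phi>])
    finally show ?thesis by (simp add: d)
  qed
  then have "(\<lambda>n. real n * (LINT p|lborel. W p * segment_average (real n *\<^sub>R e) (D a) p)) \<longlonglongrightarrow> (LINT p|lborel. Q p * \<phi> p)"
    using tendsto_minus[OF pairing_increment_tendsto[OF Q \<phi> e]] by (simp add: mult.commute)
  moreover have "(\<lambda>n. real n * (LINT p|lborel. W p * segment_average (real n *\<^sub>R e) (D a) p)) \<longlonglongrightarrow> (LINT p|lborel. U p * D a p)"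
    by (rule primitive_pairing_tendsto[OF prim W U D_cont K(1)]) (simp add: D_def K(4))
  ultimately show "(LINT p|lborel. U p * frechet_derivative \<phi> (at p) a) = - (LINT p|lborel. - Q p * \<phi> p)"
    using LIMSEQ_unique by (fastforce simp: D_def)
qed

section \<open>Primitives on the real line\<close>

lemma real_primitive_bound:
  fixes v :: "real \<Rightarrow> real"
  assumes v: "integrable lborel v"
  shows "\<bar>LINT y:{..x}|lborel. v y\<bar> \<le> (LINT y|lborel. \<bar>v y\<bar>)"
proof -
  have "norm (LINT y|lborel. indicator {..x} y *\<^sub>R v y) \<le> (LINT y|lborel. \<bar>v y\<bar>)"
  proof (rule Bochner_Integration.integral_norm_bound_integral)
    show "integrable lborel (\<lambda>y. indicator {..x} y *\<^sub>R v y)"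
      by (intro integrable_mult_indicator v) auto
  qed (auto intro: v split: split_indicator)
  then show ?thesis by (simp add: set_lebesgue_integral_def)
qed

lemma real_primitive_tendsto:
  fixes v :: "real \<Rightarrow> real"
  assumes v: "integrable lborel v" and A: "A \<in> sets borel"
    and x: "AE y in lborel. (\<lambda>n. indicator {..x n} y) \<longlonglongrightarrow> (indicator A y :: real)"
  shows "(\<lambda>n. (LINT y:{..x n}|lborel. v y)) \<longlonglongrightarrow> (LINT y:A|lborel. v y)"
  unfolding set_lebesgue_integral_def
proof (rule integral_dominated_convergence)
  have [measurable]: "v \<in> borel_measurable borel" using borel_measurable_integrable[OF v] by simp
  show "integrable lborel (\<lambda>y. \<bar>v y\<bar>)" by (intro integrable_abs v)
  show "AE y in lborel. (\<lambda>n. indicator {..x n} y *\<^sub>R v y) \<longlonglongrightarrow> indicator A y *\<^sub>R v y"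
    using x by eventually_elim (intro tendsto_intros)
  show "AE y in lborel. norm (indicator {..x n} y *\<^sub>R v y) \<le> \<bar>v y\<bar>" for n
    by (auto split: split_indicator)
  show "(\<lambda>y. indicator A y *\<^sub>R v y) \<in> borel_measurable lborel"
    "(\<lambda>y. indicator {..x n} y *\<^sub>R v y) \<in> borel_measurable lborel" for n
    using A by measurable
qed

lemma continuous_on_real_primitive:
  fixes v :: "real \<Rightarrow> real"
  assumes v: "integrable lborel v"
  shows "continuous_on UNIV (\<lambda>x. (LINT y:{..x}|lborel. v y))"
proof (rule continuous_on_sequentiallyI)
  fix x :: "nat \<Rightarrow> real" and a assume x: "x \<longlonglongrightarrow> a"
  show "(\<lambda>n. (LINT y:{..x n}|lborel. v y)) \<longlonglongrightarrow> (LINT y:{..a}|lborel. v y)"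
  proof (rule real_primitive_tendsto[OF v])
    \<comment> \<open>The indicators converge except possibly at the end point \<open>a\<close>.\<close>
    show "AE y in lborel. (\<lambda>n. indicator {..x n} y) \<longlonglongrightarrow> (indicator {..a} y :: real)"
      using AE_lborel_singleton[of a]
    proof eventually_elim
      fix y assume "y \<noteq> a"
      then consider "y < a" | "a < y" by linarith
      then have "\<forall>\<^sub>F n in sequentially. indicator {..x n} y = (indicator {..a} y :: real)"
      proof cases
        case 1
        show ?thesis using order_tendstoD(1)[OF x 1] by eventually_elim (use 1 in auto)
      next
        case 2
        show ?thesis using order_tendstoD(2)[OF x 2] by eventually_elim (use 2 in auto)
      qed
      then show "(\<lambda>n. indicator {..x n} y) \<longlonglongrightarrow> (indicator {..a} y :: real)" by (rule tendsto_eventually)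
    qed
  qed simp
qed

lemma real_primitive_at_bot:
  fixes v :: "real \<Rightarrow> real"
  assumes v: "integrable lborel v"
  shows "(\<lambda>n. (LINT y:{..x - real n}|lborel. v y)) \<longlonglongrightarrow> 0"
proof -
  have "(\<lambda>n. (LINT y:{..x - real n}|lborel. v y)) \<longlonglongrightarrow> (LINT y:{}|lborel. v y)"
  proof (rule real_primitive_tendsto[OF v])
    show "AE y in lborel. (\<lambda>n. indicator {..x - real n} y) \<longlonglongrightarrow> (indicator {} y :: real)"
    proof (rule AE_I2)
      fix y
      obtain N :: nat where N: "x - y < real N" using reals_Archimedean2 by blast
      have "\<forall>\<^sub>F n in sequentially. indicator {..x - real n} y = (indicator {} y :: real)"
        unfolding eventually_sequentially
      proof (intro exI allI impI)
        fix n assume "N \<le> n"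
        then have "real N \<le> real n" by simp
        then show "indicator {..x - real n} y = (indicator {} y :: real)" using N by auto
      qed
      then show "(\<lambda>n. indicator {..x - real n} y) \<longlonglongrightarrow> (indicator {} y :: real)" by (rule tendsto_eventually)
    qed
  qed simp
  then show ?thesis by (simp add: set_lebesgue_integral_def)
qed

lemma real_primitive_increment:
  fixes v :: "real \<Rightarrow> real"
  assumes v: "integrable lborel v" and c: "0 \<le> c"
  shows "(LINT y:{..x}|lborel. v y) - (LINT y:{..x - c}|lborel. v y) = c * (LINT s:{0..1}|lborel. v (x - s * c))"
proof (cases "c = 0")
  case False
  with c have c: "0 < c" by simp
  have [measurable]: "v \<in> borel_measurable borel" using borel_measurable_integrable[OF v] by simp
  have "(LINT y:{..x}|lborel. v y) - (LINT y:{..x - c}|lborel. v y) =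
      (LINT y|lborel. indicator {..x} y *\<^sub>R v y - indicator {..x - c} y *\<^sub>R v y)"
    unfolding set_lebesgue_integral_def
    by (rule Bochner_Integration.integral_diff[symmetric]; intro integrable_mult_indicator v; simp)
  also have "\<dots> = (LINT y|lborel. indicator {x - c..x} y *\<^sub>R v y)"
  proof (rule integral_cong_AE)
    show "AE y in lborel. indicator {..x} y *\<^sub>R v y - indicator {..x - c} y *\<^sub>R v y = indicator {x - c..x} y *\<^sub>R v y"
      using AE_lborel_singleton[of "x - c"]
      by eventually_elim (use c in \<open>auto split: split_indicator\<close>)
  qed measurable
  also have "\<dots> = \<bar>- c\<bar> *\<^sub>R (LINT s|lborel. indicator {x - c..x} (x + - c * s) *\<^sub>R v (x + - c * s))"
    by (rule lborel_integral_real_affine) (use c in simp)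
  also have "\<dots> = c * (LINT s:{0..1}|lborel. v (x - s * c))"
    unfolding set_lebesgue_integral_def using c
    by (auto intro!: Bochner_Integration.integral_cong simp: indicator_def mult.commute zero_le_mult_iff)
  finally show ?thesis .
qed simp

lemma is_primitive_real:
  fixes v :: "real \<Rightarrow> real"
  assumes v: "integrable lborel v"
  shows "is_primitive 1 v (\<lambda>x. (LINT y:{..x}|lborel. v y))"
  unfolding is_primitive_def
  using real_primitive_increment[OF v] real_primitive_at_bot[OF v] by simp

section \<open>Borel representatives of functions of time and space\<close>

lemma borel_version_exists:
  fixes v :: "'a::euclidean_space \<Rightarrow> real"
  assumes v: "(\<lambda>p. indicator S p * v p) \<in> borel_measurable lebesgue"
    and S: "S \<in> sets borel" and bound: "AE p in lebesgue. p \<in> S \<longrightarrow> \<bar>v p\<bar> \<le> M" and M: "0 \<le> M"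
  obtains V where "borel_version S v V" "\<And>p. \<bar>V p\<bar> \<le> M" "\<And>p. p \<notin> S \<Longrightarrow> V p = 0"
proof -
  obtain V0 where V0[measurable]: "V0 \<in> borel_measurable borel"
    and eq: "AE p in lborel. indicator S p * v p = V0 p"
    using completion_ex_borel_measurable_real[OF v] by auto
  define V where "V p = indicator S p * max (-M) (min M (V0 p))" for p
  show ?thesis
  proof (rule that[of V])
    show "\<bar>V p\<bar> \<le> M" for p unfolding V_def using M by (auto split: split_indicator)
    have [measurable]: "V \<in> borel_measurable borel" unfolding V_def using S by measurable
    have "AE p in lebesgue. indicator S p * v p = V0 p" using eq by (simp add: AE_completion_iff)
    then have "AE p in lebesgue. p \<in> S \<longrightarrow> V p = v p"
      using bound by eventually_elim (auto simp: V_def)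
    then show "borel_version S v V" by (simp add: borel_version_def)
  qed (simp add: V_def)
qed

lemma borel_version_compose:
  assumes "borel_version S u U" and "\<Phi> \<in> borel_measurable borel"
  shows "borel_version S (\<lambda>p. \<Phi> (u p)) (\<lambda>p. \<Phi> (U p))"
  using assms unfolding borel_version_def by (auto elim!: eventually_mono)

lemma borel_version_self: "U \<in> borel_measurable borel \<Longrightarrow> borel_version S U U"
  by (simp add: borel_version_def)

lemma AE_lborel_fst:
  assumes "AE t in lborel. P (t::'a::euclidean_space)"
  shows "AE p in (lborel :: ('a \<times> 'b::euclidean_space) measure). P (fst p)"
proof -
  obtain N where N: "{t \<in> space lborel. \<not> P t} \<subseteq> N" "emeasure lborel N = 0" "N \<in> sets lborel"
    by (rule AE_E[OF assms])
  note [measurable] = N(3)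
  have "AE t in lborel. t \<notin> N"
    using N by (intro AE_not_in) (auto simp: null_sets_def)
  have "AE p in (lborel :: 'a measure) \<Otimes>\<^sub>M (lborel :: 'b measure). fst p \<notin> N"
  proof (rule lborel_pair.AE_pair_measure[rotated])
    show "AE t in (lborel :: 'a measure). AE y in (lborel :: 'b measure). fst (t, y) \<notin> N"
      using \<open>AE t in lborel. t \<notin> N\<close> by eventually_elim simp
    show "{p \<in> space ((lborel :: 'a measure) \<Otimes>\<^sub>M (lborel :: 'b measure)). fst p \<notin> N}
        \<in> sets ((lborel :: 'a measure) \<Otimes>\<^sub>M (lborel :: 'b measure))"
      by measurable
  qed
  then show ?thesis
    unfolding lborel_prod by eventually_elim (use N(1) in auto)
qed

lemma lebesgue_integral_initial_segment:
  fixes v V :: "real \<Rightarrow> real"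
  assumes "V \<in> borel_measurable borel" "AE x in lebesgue. V x = v x"
  shows "(LINT y:{..x}|lebesgue. v y) = (LINT y:{..x}|lborel. V y)"
proof -
  have "borel_version {..x} v (\<lambda>y. indicator {..x} y * V y)"
    using assms unfolding borel_version_def by (auto elim!: eventually_mono)
  from borel_version_set_integral[OF this] show ?thesis
    by (simp add: set_lebesgue_integral_def)
qed

lemma continuous_on_lebesgue_primitive:
  fixes v :: "real \<Rightarrow> real"
  assumes v: "integrable lebesgue v"
  shows "continuous_on UNIV (\<lambda>x. LINT y:{..x}|lebesgue. v y)"
proof -
  obtain V where V: "V \<in> borel_measurable borel" and eq: "AE x in lborel. v x = V x"
    using completion_ex_borel_measurable_real[OF borel_measurable_integrable[OF v]] by auto
  have eq': "AE x in lebesgue. V x = v x" using eq by (auto simp: AE_completion_iff elim!: eventually_mono)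
  have "integrable lebesgue V"
    using v V eq' by (intro integrable_cong_AE_imp[OF v]) (auto simp: measurable_completion elim!: eventually_mono)
  then have "integrable lborel V" using V by (simp add: integrable_completion)
  then show ?thesis
    unfolding lebesgue_integral_initial_segment[OF V eq'] by (rule continuous_on_real_primitive)
qed

text \<open>A single Borel representative whose slices satisfy the bounds for every time, not only for almost every one, so that its
  primitive in \<open>x\<close> is bounded and vanishes at \<open>-\<infinity>\<close> without exceptions. A first representative is set to \<open>0\<close> at
  the times where its \<open>L\<^sup>1\<close> bound fails, a Borel set that meets \<open>(0, T)\<close> in a null set.\<close>

lemma space_time_version_exists:
  fixes w :: "real \<Rightarrow> real \<Rightarrow> real" and T :: real
  defines "S \<equiv> {0<..<T} \<times> (UNIV :: real set)"
  assumes meas: "(\<lambda>p. indicator S p * (case p of (t, x) \<Rightarrow> w t x)) \<in> borel_measurable lebesgue"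
    and bound: "AE p in lebesgue. p \<in> S \<longrightarrow> \<bar>case p of (t, x) \<Rightarrow> w t x\<bar> \<le> M" "0 \<le> M"
    and slices: "\<And>t. t \<in> {0<..<T} \<Longrightarrow> integrable lebesgue (w t)"
      "\<And>t. t \<in> {0<..<T} \<Longrightarrow> (LINT x|lebesgue. \<bar>w t x\<bar>) \<le> C" and C: "0 \<le> C"
  obtains W where "borel_version S (\<lambda>(t, x). w t x) W" "\<And>p. \<bar>W p\<bar> \<le> M"
    "\<And>t. integrable lborel (\<lambda>x. W (t, x))" "\<And>t. (LINT x|lborel. \<bar>W (t, x)\<bar>) \<le> C"
    "integrable lborel W"
    "AE t in lborel. t \<in> {0<..<T} \<longrightarrow> (AE x in lebesgue. W (t, x) = w t x)"
proof -
  have S: "S \<in> sets borel" unfolding S_def by (intro borel_open open_Times) auto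
  obtain W0 where W0: "borel_version S (\<lambda>(t, x). w t x) W0" "\<And>p. \<bar>W0 p\<bar> \<le> M" "\<And>p. p \<notin> S \<Longrightarrow> W0 p = 0"
    by (rule borel_version_exists[OF meas S bound]) blast
  have "W0 \<in> borel_measurable borel" using W0(1) by (simp add: borel_version_def)
  then have [measurable]: "W0 \<in> borel_measurable (borel \<Otimes>\<^sub>M borel)" by (simp add: borel_prod)
  define A where "A = {t. (\<integral>\<^sup>+x. ennreal \<bar>W0 (t, x)\<bar> \<partial>lborel) \<le> ennreal C}"
  have A[measurable]: "A \<in> sets borel" unfolding A_def by measurable
  define W where "W p = indicator A (fst p) * W0 p" for p
  have W_meas[measurable]: "W \<in> borel_measurable (borel \<Otimes>\<^sub>M borel)" unfolding W_def by measurable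
  have W_bd: "\<bar>W p\<bar> \<le> M" for p
    unfolding W_def using W0(2)[of p] \<open>0 \<le> M\<close> by (auto split: split_indicator)
  have nn: "(\<integral>\<^sup>+x. ennreal \<bar>W (t, x)\<bar> \<partial>lborel) \<le> ennreal C" for t
    by (cases "t \<in> A") (auto simp: W_def A_def)
  have W_slice: "integrable lborel (\<lambda>x. W (t, x))" for t
    using le_less_trans[OF nn[of t] ennreal_less_top] by (intro integrableI_bounded) auto
  have W_L1: "(LINT x|lborel. \<bar>W (t, x)\<bar>) \<le> C" for t
  proof -
    have "ennreal (LINT x|lborel. \<bar>W (t, x)\<bar>) \<le> ennreal C"
      using nn[of t] by (subst nn_integral_eq_integral[symmetric]) (auto intro: W_slice)
    then show ?thesis using C by (simp add: ennreal_le_iff)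
  qed
  have "AE p in lborel \<Otimes>\<^sub>M lborel. p \<in> S \<longrightarrow> W0 p = (case p of (t, x) \<Rightarrow> w t x)"
    using W0(1) unfolding lborel_prod by (simp add: borel_version_def AE_completion_iff)
  from lborel_pair.AE_pair[OF this]
  have good: "AE t in lborel. t \<in> {0<..<T} \<longrightarrow> t \<in> A \<and> (AE x in lebesgue. W (t, x) = w t x)"
  proof eventually_elim
    case (elim t)
    show ?case
    proof
      assume t: "t \<in> {0<..<T}"
      have eq: "AE x in lebesgue. W0 (t, x) = w t x"
        using elim t by (simp add: S_def AE_completion_iff)
      have "(\<integral>\<^sup>+x. ennreal \<bar>W0 (t, x)\<bar> \<partial>lborel) = (\<integral>\<^sup>+x. ennreal \<bar>W0 (t, x)\<bar> \<partial>lebesgue)"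
        by (simp add: nn_integral_completion)
      also have "\<dots> = (\<integral>\<^sup>+x. ennreal \<bar>w t x\<bar> \<partial>lebesgue)"
        using eq by (intro nn_integral_cong_AE) (auto elim!: eventually_mono)
      also have "\<dots> = ennreal (LINT x|lebesgue. \<bar>w t x\<bar>)"
        using slices(1)[OF t] by (intro nn_integral_eq_integral) auto
      also have "\<dots> \<le> ennreal C" using slices(2)[OF t] by (rule ennreal_leI)
      finally have "t \<in> A" by (simp add: A_def)
      then show "t \<in> A \<and> (AE x in lebesgue. W (t, x) = w t x)"
        using eq by (simp add: W_def)
    qed
  qed
  have "AE p in lborel. fst p \<in> {0<..<T} \<longrightarrow> fst p \<in> A"
    using good by (intro AE_lborel_fst) (auto elim!: eventually_mono)
  then have inA: "AE p in lebesgue. fst p \<in> {0<..<T} \<longrightarrow> fst p \<in> A" by (simp only: AE_completion_iff)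
  have "AE p in lebesgue. p \<in> S \<longrightarrow> W0 p = (case p of (t, x) \<Rightarrow> w t x)"
    using W0(1) by (simp add: borel_version_def)
  then have "AE p in lebesgue. p \<in> S \<longrightarrow> W p = (case p of (t, x) \<Rightarrow> w t x)"
    using inA by eventually_elim (auto simp: W_def S_def)
  then have version: "borel_version S (\<lambda>(t, x). w t x) W"
    using W_meas by (simp add: borel_version_def borel_prod)
  have "integrable (lborel \<Otimes>\<^sub>M lborel) W"
  proof (rule lborel_pair.Fubini_integrable)
    show "integrable lborel (\<lambda>t. LINT x|lborel. norm (W (t, x)))"
    proof (rule Bochner_Integration.integrable_bound)
      show "integrable lborel (\<lambda>t. indicator {0<..<T} t * C)"
        using emeasure_bounded_finite[of "{0<..<T}"]
        by (intro integrable_mult_left integrable_real_indicator) auto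
      show "AE t in lborel. norm (LINT x|lborel. norm (W (t, x))) \<le> norm (indicator {0<..<T} t * C)"
      proof (rule AE_I2)
        fix t
        have "0 \<le> (LINT x|lborel. \<bar>W (t, x)\<bar>)" by (rule integral_nonneg_AE) auto
        moreover have "W (t, x) = 0" if "t \<notin> {0<..<T}" for x
          using W0(3)[of "(t, x)"] that by (simp add: W_def S_def)
        ultimately show "norm (LINT x|lborel. norm (W (t, x))) \<le> norm (indicator {0<..<T} t * C)"
          using W_L1[of t] C by (cases "t \<in> {0<..<T}") auto
      qed
    qed measurable
  qed (use W_slice in auto)
  then have "integrable lborel W" by (simp add: lborel_prod)
  then show ?thesis using version W_bd W_slice W_L1 good
    by (intro that[of W]) (auto elim!: eventually_mono)
qed

section \<open>The decomposition of the strip\<close>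

lemma C1_of_Ck:
  fixes f :: "real \<Rightarrow> real"
  assumes "Ck (Suc (Suc n)) f"
  shows "(f has_real_derivative deriv f y) (at y)" and "continuous_on UNIV (deriv f)"
proof -
  show *: "(f has_real_derivative deriv f y) (at y)" for y
    using assms by (simp add: DERIV_deriv_iff_real_differentiable)
  have "frechet_derivative f (at y) = (\<lambda>h. deriv f y * h)" for y
    using frechet_derivative_at[OF *[of y, unfolded has_field_derivative_def]] by simp
  then have "deriv f = (\<lambda>y. frechet_derivative f (at y) 1)" by simp
  then show "continuous_on UNIV (deriv f)"
    using Ck_continuous_frechet[OF assms, of 1] by simp
qed

lemma is_primitive_slices:
  fixes W :: "real \<times> real \<Rightarrow> real"
  assumes "\<And>t. integrable lborel (\<lambda>x. W (t, x))"
  shows "is_primitive (0, 1) W (\<lambda>p. LINT y:{..snd p}|lborel. W (fst p, y))"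
  unfolding is_primitive_def
  using real_primitive_increment[OF assms] real_primitive_at_bot[OF assms] by (auto simp: mult.commute)

lemma Linf_norm_le:
  assumes "v \<in> borel_measurable (lebesgue_on S)" "AE p in lebesgue_on S. \<bar>v p\<bar> \<le> M"
  shows "Linf_norm S v \<le> ereal M"
  unfolding Linf_norm_def using assms by (intro esssup_I) auto

theorem theorem1p3:
  fixes M \<epsilon> T :: real
    and f h g w0 :: "real \<Rightarrow> real"
    and w u :: "real \<Rightarrow> real \<Rightarrow> real"
  assumes "0 < M" and "0 < \<epsilon>" and "\<epsilon> < M" and "0 < T"
    and f_C3: "Ck 3 f"
    and f''_bounded: "Linf_on UNIV (deriv (deriv f))"
    and w0_space: "in_L1_BV w0"
    and w0_bound: "AE x in lebesgue. \<bar>w0 x\<bar> \<le> M"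
    and h: "regularized_indicator M \<epsilon> h"
    and g: "\<And>y. g y = y * h y"
    and w_solution: "nonlocal_entropy_solution T f g w0 w"
    and w_bound: "Linf_norm ({0<..<T} \<times> UNIV) (\<lambda>(t, x). w t x) \<le> ereal M"
    and w_L1: "\<And>t. t \<in> {0..T} \<Longrightarrow> integrable lebesgue (w t) \<and> L1_norm (w t) \<le> L1_norm w0"
    and u: "\<And>t x. u t x = (LINT y:{..x}|lebesgue. w t y)"
  shows "entropy_solution_ae_on T f (I_set T M \<epsilon> w) u
    \<and> (\<exists>ux. has_weak_derivative ({0<..<T} \<times> UNIV) (\<lambda>(t, x). u t x) (0, 1) ux
        \<and> (AE p in lebesgue. p \<in> I_set T M \<epsilon> w \<longrightarrow> \<bar>ux p\<bar> < M)
        \<and> (AE p in lebesgue. p \<in> J_set T M w \<longrightarrow> \<bar>ux p\<bar> = M))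
    \<and> (\<exists>ut fx. has_weak_derivative ({0<..<T} \<times> UNIV) (\<lambda>(t, x). u t x) (1, 0) ut
        \<and> has_weak_derivative ({0<..<T} \<times> UNIV) (\<lambda>(t, x). f (u t x)) (0, 1) fx
        \<and> (AE (t, x) in lebesgue. (t, x) \<in> K_set T M \<epsilon> w \<longrightarrow>
              ut (t, x) + fx (t, x) * h (w t x) = 0))
    \<and> Linf_W1inf T u
    \<and> (\<forall>t\<in>{0..T}. continuous_on UNIV (u t))"
proof -
  define S where "S = {0<..<T} \<times> (UNIV :: real set)"
  have S_open: "open S" unfolding S_def by (intro open_Times) auto
  have S[measurable]: "S \<in> sets borel" by (rule borel_open[OF S_open])
  define C where "C = L1_norm w0"
  have C: "0 \<le> C" unfolding C_def L1_norm_def by (rule integral_nonneg_AE) auto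
  have w_meas: "(\<lambda>p. indicator S p * (case p of (t, x) \<Rightarrow> w t x)) \<in> borel_measurable lebesgue"
  proof -
    have S': "{0..T} \<times> (UNIV :: real set) \<in> sets borel" by (intro borel_closed closed_Times) auto
    have "(\<lambda>(t, x). w t x) \<in> borel_measurable (lebesgue_on ({0..T} \<times> UNIV))"
      using w_solution by (simp add: nonlocal_entropy_solution_def Linf_L1_BV_def)
    then have [measurable]: "(\<lambda>p. indicator ({0..T} \<times> UNIV) p *\<^sub>R (case p of (t, x) \<Rightarrow> w t x)) \<in> borel_measurable lebesgue"
      using S' by (subst (asm) borel_measurable_restrict_space_iff) auto
    have [measurable]: "indicator S \<in> borel_measurable lebesgue"
      by (rule measurable_completion) simp
    have "(\<lambda>p. indicator S p * (indicator ({0..T} \<times> UNIV) p *\<^sub>R (case p of (t, x) \<Rightarrow> w t x)))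
        \<in> borel_measurable lebesgue"
      by measurable
    also have "(\<lambda>p. indicator S p * (indicator ({0..T} \<times> UNIV) p *\<^sub>R (case p of (t, x) \<Rightarrow> w t x)))
        = (\<lambda>p. indicator S p * (case p of (t, x) \<Rightarrow> w t x))"
      by (auto simp: S_def fun_eq_iff split: split_indicator)
    finally show ?thesis .
  qed
  have w_bd: "AE p in lebesgue. p \<in> S \<longrightarrow> \<bar>case p of (t, x) \<Rightarrow> w t x\<bar> \<le> M"
  proof -
    have "AE p in lebesgue_on S. ereal \<bar>case p of (t, x) \<Rightarrow> w t x\<bar> \<le> Linf_norm S (\<lambda>(t, x). w t x)"
      unfolding Linf_norm_def by (rule esssup_AE)
    then have "AE p in lebesgue_on S. \<bar>case p of (t, x) \<Rightarrow> w t x\<bar> \<le> M"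
    proof eventually_elim
      case (elim p)
      then have "ereal \<bar>case p of (t, x) \<Rightarrow> w t x\<bar> \<le> ereal M"
        using w_bound unfolding S_def by (rule order_trans)
      then show ?case by simp
    qed
    then show ?thesis by (subst (asm) AE_restrict_space_iff) auto
  qed
  have w_slices: "integrable lebesgue (w t)" "(LINT x|lebesgue. \<bar>w t x\<bar>) \<le> C" if "t \<in> {0<..<T}" for t
    using w_L1[of t] that by (auto simp: L1_norm_def C_def)
  obtain W where W: "borel_version S (\<lambda>(t, x). w t x) W" "\<And>p. \<bar>W p\<bar> \<le> M"
    and W_slice: "\<And>t. integrable lborel (\<lambda>x. W (t, x))" "\<And>t. (LINT x|lborel. \<bar>W (t, x)\<bar>) \<le> C"
    and W_int: "integrable lborel W"
    and W_good: "AE t in lborel. t \<in> {0<..<T} \<longrightarrow> (AE x in lebesgue. W (t, x) = w t x)"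
    using space_time_version_exists[OF w_meas[unfolded S_def] w_bd[unfolded S_def] less_imp_le[OF \<open>0 < M\<close>]
        w_slices C] unfolding S_def by blast
  have W_meas[measurable]: "W \<in> borel_measurable borel" using W(1) by (simp add: borel_version_def)
  have W_meas'[measurable]: "W \<in> borel_measurable (borel \<Otimes>\<^sub>M borel)" by (simp add: borel_prod)
  have W_eq: "AE p in lebesgue. p \<in> S \<longrightarrow> W p = (case p of (t, x) \<Rightarrow> w t x)"
    using W(1) by (simp add: borel_version_def)
  define U where "U p = (LINT y:{..snd p}|lborel. W (fst p, y))" for p
  have U_bd: "\<bar>U p\<bar> \<le> C" for p
    unfolding U_def using real_primitive_bound[OF W_slice(1)] W_slice(2) by (rule order_trans)
  have U_prim: "is_primitive (0, 1) W U"
    unfolding U_def[abs_def] by (rule is_primitive_slices[OF W_slice(1)])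
  have U_meas[measurable]: "U \<in> borel_measurable borel"
  proof -
    have "(\<lambda>p. LINT y|lborel. (if y \<le> snd p then W (fst p, y) else 0)) \<in> borel_measurable (borel \<Otimes>\<^sub>M borel)"
      by measurable
    also have "(\<lambda>p. LINT y|lborel. (if y \<le> snd p then W (fst p, y) else 0)) = U"
      unfolding U_def set_lebesgue_integral_def fun_eq_iff
      by (auto intro!: Bochner_Integration.integral_cong simp: indicator_def)
    finally show ?thesis by (simp add: borel_prod)
  qed
  have slice_eq: "u t x = U (t, x)" if "AE x in lebesgue. W (t, x) = w t x" for t x
    unfolding u U_def using lebesgue_integral_initial_segment[OF _ that] by simp
  have u_good: "AE t in lborel. t \<in> {0<..<T} \<longrightarrow> (\<forall>x. u t x = U (t, x))"
    using W_good by eventually_elim (auto intro: slice_eq)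
  have U_eq: "AE p in lebesgue. p \<in> S \<longrightarrow> U p = (case p of (t, x) \<Rightarrow> u t x)"
  proof -
    have "AE p in (lborel :: (real \<times> real) measure). fst p \<in> {0<..<T} \<longrightarrow> (\<forall>x. u (fst p) x = U (fst p, x))"
      by (rule AE_lborel_fst[OF u_good])
    then have "AE p in (lborel :: (real \<times> real) measure). p \<in> S \<longrightarrow> U p = (case p of (t, x) \<Rightarrow> u t x)"
      by eventually_elim (auto simp: S_def)
    then show ?thesis by (simp only: AE_completion_iff)
  qed
  have U: "borel_version S (\<lambda>(t, x). u t x) U"
    using U_eq by (simp add: borel_version_def)
  have f: "(f has_real_derivative deriv f y) (at y)" and f': "continuous_on UNIV (deriv f)" for y
    using C1_of_Ck[of 1 f] f_C3 by (simp_all add: eval_nat_numeral)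
  have contf: "continuous_on UNIV f"
    using f by (meson DERIV_isCont continuous_at_imp_continuous_on)
  note f_meas[measurable] = borel_measurable_continuous_onI[OF contf] borel_measurable_continuous_onI[OF f']
  have h_cont: "continuous_on UNIV h" and h1: "\<And>y. \<bar>y\<bar> \<le> M - \<epsilon> \<Longrightarrow> h y = 1"
    using h lipschitz_on_continuous_on by (auto simp: regularized_indicator_def abs_le_iff)
  note h_meas[measurable] = borel_measurable_continuous_onI[OF h_cont]
  obtain L where L: "\<And>y. \<bar>y\<bar> \<le> C \<Longrightarrow> \<bar>deriv f y\<bar> \<le> L"
    by (rule continuous_bounded_on_interval[OF f']) blast
  obtain B where B: "\<And>y. \<bar>y\<bar> \<le> C \<Longrightarrow> \<bar>f y\<bar> \<le> B"
    by (rule continuous_bounded_on_interval[OF contf]) blast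
  obtain H where H: "\<And>y. \<bar>y\<bar> \<le> M \<Longrightarrow> \<bar>h y\<bar> \<le> H"
    by (rule continuous_bounded_on_interval[OF h_cont]) blast
  have L0: "0 \<le> L" using L[of 0] C by auto
  have H0: "0 \<le> H" using H[of 0] \<open>0 < M\<close> by auto
  \<comment> \<open>The flux of the nonlocal equation.\<close>
  define Q where "Q p = deriv f (U p) * (W p * h (W p))" for p
  have Q_meas[measurable]: "Q \<in> borel_measurable borel" unfolding Q_def by measurable
  have Q_le: "\<bar>Q p\<bar> \<le> L * H * \<bar>W p\<bar>" for p
  proof -
    have "\<bar>deriv f (U p)\<bar> * (\<bar>W p\<bar> * \<bar>h (W p)\<bar>) \<le> L * (\<bar>W p\<bar> * H)"
      using L[OF U_bd[of p]] H[OF W(2)[of p]] L0 by (intro mult_mono) auto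
    then show ?thesis by (simp add: Q_def abs_mult mult_ac)
  qed
  have Q_bd: "\<bar>Q p\<bar> \<le> L * H * M" for p
    using order_trans[OF Q_le mult_left_mono[OF W(2)[of p]]] L0 H0 by simp
  have Q_int: "integrable lborel Q"
    by (rule Bochner_Integration.integrable_bound[OF integrable_mult_right[OF integrable_abs[OF W_int], of "L * H"]])
       (use Q_le L0 H0 in \<open>auto simp: abs_mult\<close>)
  have law: "(LINT p|lborel. W p * frechet_derivative \<phi> (at p) (1, 0) + Q p * frechet_derivative \<phi> (at p) (0, 1)) = 0"
    if \<phi>: "\<phi> \<in> test_functions S" for \<phi>
  proof -
    obtain K where K: "compact K" "K \<subseteq> S" "\<And>p. p \<notin> K \<Longrightarrow> \<phi> p = 0"
        "\<And>p a. p \<notin> K \<Longrightarrow> frechet_derivative \<phi> (at p) a = 0"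
      using test_functions_support[OF \<phi>] by blast
    note [measurable] = test_functions_measurable(2)[OF \<phi>]
    have "\<phi> \<in> test_functions ({..<T} \<times> UNIV)"
      by (rule subsetD[OF test_functions_mono \<phi>]) (auto simp: S_def)
    moreover have "weak_solution T (\<lambda>t x. deriv f (primitive w t x)) g w0 w"
      using w_solution by (simp add: nonlocal_entropy_solution_def weak_entropy_solution_def)
    ultimately have weak: "(LINT (t, x):S|lebesgue. w t x * frechet_derivative \<phi> (at (t, x)) (1, 0)
          + deriv f (u t x) * g (w t x) * frechet_derivative \<phi> (at (t, x)) (0, 1))
        + (LINT x|lebesgue. w0 x * \<phi> (0, x)) = 0"
      unfolding weak_solution_def primitive_def S_def by (simp add: u)
    \<comment> \<open>Test functions supported in the open strip do not see the initial data.\<close>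
    have "(0, x) \<notin> K" for x using K(2) by (auto simp: S_def)
    then have "(LINT x|lebesgue. w0 x * \<phi> (0, x)) = 0" by (simp add: K(3))
    moreover have "(LINT (t, x):S|lebesgue. w t x * frechet_derivative \<phi> (at (t, x)) (1, 0)
          + deriv f (u t x) * g (w t x) * frechet_derivative \<phi> (at (t, x)) (0, 1)) =
        (LINT p|lborel. W p * frechet_derivative \<phi> (at p) (1, 0) + Q p * frechet_derivative \<phi> (at p) (0, 1))"
    proof (rule borel_version_set_integral[OF _ S])
      have "AE p in lebesgue. p \<in> S \<longrightarrow>
          W p * frechet_derivative \<phi> (at p) (1, 0) + Q p * frechet_derivative \<phi> (at p) (0, 1) =
          (case p of (t, x) \<Rightarrow> w t x * frechet_derivative \<phi> (at (t, x)) (1, 0)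
          + deriv f (u t x) * g (w t x) * frechet_derivative \<phi> (at (t, x)) (0, 1))"
        using W_eq U_eq by eventually_elim (auto simp: Q_def g)
      then show "borel_version S (\<lambda>(t, x). w t x * frechet_derivative \<phi> (at (t, x)) (1, 0)
          + deriv f (u t x) * g (w t x) * frechet_derivative \<phi> (at (t, x)) (0, 1))
        (\<lambda>p. W p * frechet_derivative \<phi> (at p) (1, 0) + Q p * frechet_derivative \<phi> (at p) (0, 1))"
        by (simp add: borel_version_def)
      show "W p * frechet_derivative \<phi> (at p) (1, 0) + Q p * frechet_derivative \<phi> (at p) (0, 1) = 0"
        if "p \<notin> S" for p
      proof -
        have "p \<notin> K" using K(2) that by auto
        then show ?thesis by (simp add: K(4))
      qed
    qed
    ultimately show ?thesis using weak by simp
  qed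
  have Ux: "distributional_derivative S U (0, 1) W"
    by (rule distributional_derivative_primitive[OF U_prim W_int U_meas U_bd]) (simp add: zero_prod_def)
  have Ut: "distributional_derivative S U (1, 0) (\<lambda>p. - Q p)"
    by (rule distributional_derivative_primitive_of_conservation_law[OF U_prim W_int U_meas U_bd Q_int _ _ law])
       (auto simp: zero_prod_def S_def)
  define fx where "fx p = deriv f (U p) * W p" for p
  have fx_meas[measurable]: "fx \<in> borel_measurable borel" unfolding fx_def by measurable
  have fx_bd: "\<bar>fx p\<bar> \<le> L * M" for p
    unfolding fx_def abs_mult using L[OF U_bd[of p]] W(2)[of p] L0 by (intro mult_mono) auto
  have Q_ver: "borel_version S (\<lambda>p. - Q p) (\<lambda>p. - Q p)" by (rule borel_version_self) measurable
  have Q_bd': "\<bar>- Q p\<bar> \<le> L * H * M" for p using Q_bd[of p] by simp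
  have ux: "has_weak_derivative S (\<lambda>(t, x). u t x) (0, 1) W"
    using has_weak_derivative_iff_borel_version[OF S U U_bd borel_version_self[OF W_meas] W(2)] Ux by blast
  have ut: "has_weak_derivative S (\<lambda>(t, x). u t x) (1, 0) (\<lambda>p. - Q p)"
    using has_weak_derivative_iff_borel_version[OF S U U_bd Q_ver Q_bd'] Ut by blast
  have comp: "has_weak_derivative S (\<lambda>(t, x). G (u t x)) e V"
    if DD: "distributional_derivative S (\<lambda>p. G (U p)) e V" and [measurable]: "G \<in> borel_measurable borel"
      and G: "\<And>y. \<bar>y\<bar> \<le> C \<Longrightarrow> \<bar>G y\<bar> \<le> B'" and V: "V \<in> borel_measurable borel" "\<And>p. \<bar>V p\<bar> \<le> D"
    for G V B' D and e :: "real \<times> real"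
  proof -
    have "borel_version S (\<lambda>p. G (case p of (t, x) \<Rightarrow> u t x)) (\<lambda>p. G (U p))"
      by (rule borel_version_compose[OF U]) simp
    from has_weak_derivative_iff_borel_version[OF S this G[OF U_bd] borel_version_self[OF V(1)] V(2)] DD
    show ?thesis by (simp add: case_prod_beta')
  qed
  have fu: "has_weak_derivative S (\<lambda>(t, x). f (u t x)) (0, 1) fx"
    unfolding fx_def
    by (rule comp[OF distributional_chain_rule[OF S_open Ux U_meas U_bd W_meas W(2) f f'] f_meas(1) B])
       (use fx_meas fx_bd in \<open>auto simp: fx_def[abs_def]\<close>)
  have sgn_mult: "\<bar>sgn a * b\<bar> \<le> \<bar>b\<bar>" for a b :: real by (simp add: abs_mult sgn_if)
  have entropy: "has_weak_derivative S (\<lambda>(t, x). \<bar>u t x - c\<bar>) (1, 0) (\<lambda>p. sgn (U p - c) * - Q p)" for c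
  proof -
    have DD: "distributional_derivative S (\<lambda>p. sgn (U p - c) * (U p - c)) (1, 0) (\<lambda>p. sgn (U p - c) * 1 * - Q p)"
      by (rule distributional_entropy_flux[OF S_open Ut U_meas U_bd _ Q_bd', where f="\<lambda>y. y" and f'="\<lambda>y. 1"])
         (auto intro!: derivative_eq_intros)
    have eq: "sgn a * a = \<bar>a\<bar>" for a :: real by (simp add: sgn_if)
    have "\<bar>sgn (U p - c) * - Q p\<bar> \<le> L * H * M" for p
      using sgn_mult[of "U p - c" "- Q p"] Q_bd'[of p] by linarith
    moreover have "\<bar>\<bar>y - c\<bar>\<bar> \<le> C + \<bar>c\<bar>" if "\<bar>y\<bar> \<le> C" for y using that by linarith
    ultimately show ?thesis
      using comp[of "\<lambda>y. \<bar>y - c\<bar>" "(1, 0)" "\<lambda>p. sgn (U p - c) * - Q p" "C + \<bar>c\<bar>" "L * H * M"] DD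
      unfolding eq by simp
  qed
  have flux: "has_weak_derivative S (\<lambda>(t, x). sgn (u t x - c) * (f (u t x) - f c)) (0, 1)
      (\<lambda>p. sgn (U p - c) * fx p)" for c
  proof -
    have DD: "distributional_derivative S (\<lambda>p. sgn (U p - c) * (f (U p) - f c)) (0, 1)
        (\<lambda>p. sgn (U p - c) * deriv f (U p) * W p)"
      by (rule distributional_entropy_flux[OF S_open Ux U_meas U_bd W_meas W(2) f f'])
    have "\<bar>sgn (U p - c) * fx p\<bar> \<le> L * M" for p
      using sgn_mult[of "U p - c" "fx p"] fx_bd[of p] by linarith
    moreover have "\<bar>sgn (y - c) * (f y - f c)\<bar> \<le> B + \<bar>f c\<bar>" if "\<bar>y\<bar> \<le> C" for y
      using sgn_mult[of "y - c" "f y - f c"] B[OF that] by linarith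
    ultimately show ?thesis
      using comp[of "\<lambda>y. sgn (y - c) * (f y - f c)" "(0, 1)" "\<lambda>p. sgn (U p - c) * fx p" "B + \<bar>f c\<bar>" "L * M"] DD
      by (simp add: fx_def mult.assoc)
  qed
  \<comment> \<open>With \<open>- Q\<close> the time derivative and \<open>fx\<close> that of \<open>f(u)\<close> in \<open>x\<close>, this is the equation on the whole strip.\<close>
  have pde: "- Q p + fx p * h (W p) = 0" for p by (simp add: Q_def fx_def)
  have on_I: "AE p in lebesgue. p \<in> I_set T M \<epsilon> w \<longrightarrow> \<bar>W p\<bar> \<le> M - \<epsilon>"
    using W_eq by eventually_elim (auto simp: I_set_def S_def)
  have pde_I: "AE p in lebesgue. p \<in> I_set T M \<epsilon> w \<longrightarrow> - Q p + fx p = 0"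
    using on_I
  proof eventually_elim
    case (elim p)
    then show ?case using pde[of p] h1[of "W p"] by auto
  qed
  have "entropy_solution_ae_on T f (I_set T M \<epsilon> w) u"
    unfolding entropy_solution_ae_on_def S_def[symmetric]
  proof (intro conjI allI)
    show "\<exists>ut fx. has_weak_derivative S (\<lambda>(t, x). u t x) (1, 0) ut \<and>
        has_weak_derivative S (\<lambda>(t, x). f (u t x)) (0, 1) fx \<and>
        (AE p in lebesgue. p \<in> I_set T M \<epsilon> w \<longrightarrow> ut p + fx p = 0)"
      using ut fu pde_I by blast
    fix c
    have "AE p in lebesgue. p \<in> I_set T M \<epsilon> w \<longrightarrow> sgn (U p - c) * - Q p + sgn (U p - c) * fx p \<le> 0"
      using pde_I
    proof eventually_elim
      case (elim p)
      have "sgn (U p - c) * - Q p + sgn (U p - c) * fx p = sgn (U p - c) * (- Q p + fx p)"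
        by (simp add: algebra_simps)
      with elim show ?case by simp
    qed
    then show "\<exists>\<eta>t qx. has_weak_derivative S (\<lambda>(t, x). \<bar>u t x - c\<bar>) (1, 0) \<eta>t \<and>
        has_weak_derivative S (\<lambda>(t, x). sgn (u t x - c) * (f (u t x) - f c)) (0, 1) qx \<and>
        (AE p in lebesgue. p \<in> I_set T M \<epsilon> w \<longrightarrow> \<eta>t p + qx p \<le> 0)"
      using entropy flux by blast
  qed
  moreover have "\<exists>ux. has_weak_derivative S (\<lambda>(t, x). u t x) (0, 1) ux
        \<and> (AE p in lebesgue. p \<in> I_set T M \<epsilon> w \<longrightarrow> \<bar>ux p\<bar> < M)
        \<and> (AE p in lebesgue. p \<in> J_set T M w \<longrightarrow> \<bar>ux p\<bar> = M)"
  proof (intro exI conjI)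
    show "AE p in lebesgue. p \<in> I_set T M \<epsilon> w \<longrightarrow> \<bar>W p\<bar> < M"
      using on_I by eventually_elim (use \<open>0 < \<epsilon>\<close> in auto)
    show "AE p in lebesgue. p \<in> J_set T M w \<longrightarrow> \<bar>W p\<bar> = M"
      using W_eq by eventually_elim (auto simp: J_set_def S_def)
  qed (rule ux)
  moreover have "\<exists>ut fx. has_weak_derivative S (\<lambda>(t, x). u t x) (1, 0) ut
        \<and> has_weak_derivative S (\<lambda>(t, x). f (u t x)) (0, 1) fx
        \<and> (AE (t, x) in lebesgue. (t, x) \<in> K_set T M \<epsilon> w \<longrightarrow> ut (t, x) + fx (t, x) * h (w t x) = 0)"
  proof (intro exI conjI)
    show "AE (t, x) in lebesgue. (t, x) \<in> K_set T M \<epsilon> w \<longrightarrow> - Q (t, x) + fx (t, x) * h (w t x) = 0"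
      using W_eq
    proof eventually_elim
      case (elim p)
      then show ?case using pde[of p] by (auto simp: K_set_def S_def)
    qed
  qed (rule ut fu)+
  moreover have "Linf_W1inf T u"
    unfolding Linf_W1inf_def S_def[symmetric]
  proof (intro conjI exI)
    show "(\<lambda>(t, x). u t x) \<in> borel_measurable (lebesgue_on S)"
      using borel_version_times_indicator(2)[OF U S]
      by (subst borel_measurable_restrict_space_iff) auto
    have "AE t in lborel. t \<in> {0<..<T} \<longrightarrow> (\<exists>v. has_weak_derivative UNIV (u t) 1 v \<and>
        Linf_norm UNIV (u t) + Linf_norm UNIV v \<le> ereal (C + M))"
      using u_good
    proof eventually_elim
      case (elim t)
      show ?case
      proof
        assume "t \<in> {0<..<T}"
        then have ut_eq: "u t = (\<lambda>x. U (t, x))" using elim by auto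
        have slice_meas: "(\<lambda>x. U (t, x)) \<in> borel_measurable borel" "(\<lambda>x. W (t, x)) \<in> borel_measurable borel"
        proof -
          have [measurable]: "U \<in> borel_measurable (borel \<Otimes>\<^sub>M borel)" by (simp add: borel_prod)
          show "(\<lambda>x. U (t, x)) \<in> borel_measurable borel" "(\<lambda>x. W (t, x)) \<in> borel_measurable borel"
            by measurable
        qed
        have "is_primitive 1 (\<lambda>x. W (t, x)) (\<lambda>x. U (t, x))"
          using is_primitive_real[OF W_slice(1)] by (simp add: U_def)
        then have "distributional_derivative UNIV (\<lambda>x. U (t, x)) 1 (\<lambda>x. W (t, x))"
          by (rule distributional_derivative_primitive[OF _ W_slice(1) slice_meas(1) U_bd]) simp
        then have "has_weak_derivative UNIV (u t) 1 (\<lambda>x. W (t, x))"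
          unfolding ut_eq
          using has_weak_derivative_iff_borel_version[OF _ borel_version_self[OF slice_meas(1)] U_bd
              borel_version_self[OF slice_meas(2)] W(2)] by simp
        moreover have "Linf_norm UNIV (u t) \<le> ereal C" "Linf_norm UNIV (\<lambda>x. W (t, x)) \<le> ereal M"
          unfolding ut_eq using slice_meas U_bd W(2)
          by (intro Linf_norm_le; simp add: measurable_completion lebesgue_on_UNIV_eq)+
        ultimately show "\<exists>v. has_weak_derivative UNIV (u t) 1 v \<and>
            Linf_norm UNIV (u t) + Linf_norm UNIV v \<le> ereal (C + M)"
          using add_mono[of _ "ereal C" _ "ereal M"] by fastforce
      qed
    qed
    then show "AE t in lebesgue_on {0<..<T}. \<exists>v. has_weak_derivative UNIV (u t) 1 v \<and>
        Linf_norm UNIV (u t) + Linf_norm UNIV v \<le> ereal (C + M)"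
      by (subst AE_restrict_space_iff) (auto simp: AE_completion_iff)
  qed
  moreover have "\<forall>t\<in>{0..T}. continuous_on UNIV (u t)"
  proof
    fix t assume "t \<in> {0..T}"
    then have "continuous_on UNIV (\<lambda>x. LINT y:{..x}|lebesgue. w t y)"
      using w_L1 by (intro continuous_on_lebesgue_primitive) blast
    moreover have "u t = (\<lambda>x. LINT y:{..x}|lebesgue. w t y)" using u by (simp add: fun_eq_iff)
    ultimately show "continuous_on UNIV (u t)" by simp
  qed
  ultimately show ?thesis unfolding S_def by blast
qed

end
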